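(* Let $\tau\in\{1,-1\}$ and let $\alpha(x_1,x_2)$ be a solution of the elliptic sine-Gordon equation $$\alpha_{x_1x_1}+\alpha_{x_2x_2}=\sin\alpha .\qquad(\ast)$$ Let $\alpha'$ and $\alpha''$ be solutions of the elliptic sinh-Gordon equation $u_{x_1x_1}+u_{x_2x_2}=\sinh u$ associated to $\alpha$ by the $\phi_1$- (resp. $\phi_2$-) B\"acklund transformation $\mathcal{B}^{1}$ defined in the context. If $\phi_1\ne\phi_2$, then there exists a unique solution $\alpha^*$ of $(\ast)$ which is associated to $\alpha'$ and $\alpha''$ by the $\phi_2$- (resp. $\phi_1$-) B\"acklund transformation $\mathcal{B}^{0}$ defined in the context. Moreover, $\alpha^*$ is given algebraically by $$\tan\frac{\alpha^*}{2}=\frac{\tilde P-\tilde Q\tan\bigl(\frac{\alpha}{2}\bigr)}{\tilde Q+\tilde P\tan\bigl(\frac{\alpha}{2}\bigr)},$$ where $$\tilde P=-\tau(\sinh\phi_1-\sinh\phi_2)\sinh\Bigl(\frac{\alpha''-\alpha'}{2}\Bigr),\qquad \tilde Q=(1+\sinh\phi_1\sinh\phi_2)\cosh\Bigl(\frac{\alpha''-\alpha'}{2}\Bigr)-\cosh\phi_1\cosh\phi_2 .$$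
   Context: Subscripts $x_i$ denote partial derivatives. The constant $\tau$ is the same in all the transformations, and the parameters $\phi$ (in particular $\phi_1,\phi_2$) are constants in $[0,\infty)$. $\beta'$ is associated to $\beta$ by the $\phi$-B\"acklund transformation $\mathcal{B}^{1}$ if $$\beta'_{x_1}-\beta_{x_2}=\frac{2}{\cosh\phi}\sinh\frac{\beta'}{2}\cos\frac{\beta}{2}+\frac{2\tau\sinh\phi}{\cosh\phi}\cosh\frac{\beta'}{2}\sin\frac{\beta}{2},$$ $$\beta'_{x_2}+\beta_{x_1}=-\frac{2}{\cosh\phi}\cosh\frac{\beta'}{2}\sin\frac{\beta}{2}+\frac{2\tau\sinh\phi}{\cosh\phi}\sinh\frac{\beta'}{2}\cos\frac{\beta}{2}.$$ $\beta'$ is associated to $\beta$ by the $\phi$-B\"acklund transformation $\mathcal{B}^{0}$ if $$\beta'_{x_1}-\beta_{x_2}=\frac{2}{\cosh\phi}\sin\frac{\beta'}{2}\cosh\frac{\beta}{2}+\frac{2\tau\sinh\phi}{\cosh\phi}\cos\frac{\beta'}{2}\sinh\frac{\beta}{2},$$ $$\beta'_{x_2}+\beta_{x_1}=-\frac{2}{\cosh\phi}\cos\frac{\beta'}{2}\sinh\frac{\beta}{2}+\frac{2\tau\sinh\phi}{\cosh\phi}\sin\frac{\beta'}{2}\cosh\frac{\beta}{2}.$$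
   Formalization: Literal uniqueness of α* fails (α*+4π is also associated; for α=α'=α''=0 both 0 and 2π are), so uniqueness is stated up to adding 4πk, with the extra solutions α+2π+4πk allowed only if α''=−α' identically; the domain is an open connected set. *)

theory Defs
  imports "HOL-Analysis.Analysis"
begin

definition pd1 :: "(real \<times> real \<Rightarrow> real) \<Rightarrow> real \<times> real \<Rightarrow> real" where
  "pd1 u x = deriv (\<lambda>t. u (t, snd x)) (fst x)"

definition pd2 :: "(real \<times> real \<Rightarrow> real) \<Rightarrow> real \<times> real \<Rightarrow> real" where
  "pd2 u x = deriv (\<lambda>t. u (fst x, t)) (snd x)"

text \<open>Only used for open \<open>U\<close>. The explicit differentiability conditions are needed because
  \<^const>\<open>deriv\<close> is total.\<close>

definition C1_on :: "(real \<times> real) set \<Rightarrow> (real \<times> real \<Rightarrow> real) \<Rightarrow> bool" where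
  "C1_on U u \<longleftrightarrow>
     (\<forall>x\<in>U. (\<lambda>t. u (t, snd x)) differentiable (at (fst x)) \<and>
            (\<lambda>t. u (fst x, t)) differentiable (at (snd x))) \<and>
     continuous_on U (pd1 u) \<and> continuous_on U (pd2 u)"

definition C2_on :: "(real \<times> real) set \<Rightarrow> (real \<times> real \<Rightarrow> real) \<Rightarrow> bool" where
  "C2_on U u \<longleftrightarrow> C1_on U u \<and> C1_on U (pd1 u) \<and> C1_on U (pd2 u)"

text \<open>Solutions are classical, on an open set \<open>U\<close> of the \<open>(x\<^sub>1, x\<^sub>2)\<close>-plane.\<close>

definition elliptic_sine_Gordon ::
  "(real \<times> real) set \<Rightarrow> (real \<times> real \<Rightarrow> real) \<Rightarrow> bool" where
  "elliptic_sine_Gordon U u \<longleftrightarrow>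
     C2_on U u \<and> (\<forall>x\<in>U. pd1 (pd1 u) x + pd2 (pd2 u) x = sin (u x))"

definition elliptic_sinh_Gordon ::
  "(real \<times> real) set \<Rightarrow> (real \<times> real \<Rightarrow> real) \<Rightarrow> bool" where
  "elliptic_sinh_Gordon U u \<longleftrightarrow>
     C2_on U u \<and> (\<forall>x\<in>U. pd1 (pd1 u) x + pd2 (pd2 u) x = sinh (u x))"

text \<open>\<open>Baecklund1 \<tau> \<phi> U \<beta> \<beta>'\<close>: on \<open>U\<close>, \<open>\<beta>'\<close> is associated to \<open>\<beta>\<close> by the \<open>\<phi>\<close>-transformation
  \<open>\<B>\<^sup>1\<close>; likewise \<open>Baecklund0\<close> for \<open>\<B>\<^sup>0\<close>. The original function comes first, the transformed
  one second.\<close>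

definition Baecklund1 ::
  "real \<Rightarrow> real \<Rightarrow> (real \<times> real) set \<Rightarrow> (real \<times> real \<Rightarrow> real) \<Rightarrow> (real \<times> real \<Rightarrow> real) \<Rightarrow> bool" where
  "Baecklund1 \<tau> \<phi> U \<beta> \<beta>' \<longleftrightarrow>
     (\<forall>x\<in>U.
        pd1 \<beta>' x - pd2 \<beta> x =
          2 / cosh \<phi> * sinh (\<beta>' x / 2) * cos (\<beta> x / 2)
          + 2 * \<tau> * sinh \<phi> / cosh \<phi> * cosh (\<beta>' x / 2) * sin (\<beta> x / 2) \<and>
        pd2 \<beta>' x + pd1 \<beta> x =
          - (2 / cosh \<phi>) * cosh (\<beta>' x / 2) * sin (\<beta> x / 2)
          + 2 * \<tau> * sinh \<phi> / cosh \<phi> * sinh (\<beta>' x / 2) * cos (\<beta> x / 2))"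

definition Baecklund0 ::
  "real \<Rightarrow> real \<Rightarrow> (real \<times> real) set \<Rightarrow> (real \<times> real \<Rightarrow> real) \<Rightarrow> (real \<times> real \<Rightarrow> real) \<Rightarrow> bool" where
  "Baecklund0 \<tau> \<phi> U \<beta> \<beta>' \<longleftrightarrow>
     (\<forall>x\<in>U.
        pd1 \<beta>' x - pd2 \<beta> x =
          2 / cosh \<phi> * sin (\<beta>' x / 2) * cosh (\<beta> x / 2)
          + 2 * \<tau> * sinh \<phi> / cosh \<phi> * cos (\<beta>' x / 2) * sinh (\<beta> x / 2) \<and>
        pd2 \<beta>' x + pd1 \<beta> x =
          - (2 / cosh \<phi>) * cos (\<beta>' x / 2) * sinh (\<beta> x / 2)
          + 2 * \<tau> * sinh \<phi> / cosh \<phi> * sin (\<beta>' x / 2) * cosh (\<beta> x / 2))"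

text \<open>The coefficients \<open>P\<close> and \<open>Q\<close> of the superposition formula, as functions of the values
  \<open>a' = \<alpha>'(x)\<close> and \<open>a'' = \<alpha>''(x)\<close>.\<close>

definition P_tilde :: "real \<Rightarrow> real \<Rightarrow> real \<Rightarrow> real \<Rightarrow> real \<Rightarrow> real" where
  "P_tilde \<tau> \<phi>1 \<phi>2 a' a'' = - \<tau> * (sinh \<phi>1 - sinh \<phi>2) * sinh ((a'' - a') / 2)"

definition Q_tilde :: "real \<Rightarrow> real \<Rightarrow> real \<Rightarrow> real \<Rightarrow> real" where
  "Q_tilde \<phi>1 \<phi>2 a' a'' =
     (1 + sinh \<phi>1 * sinh \<phi>2) * cosh ((a'' - a') / 2) - cosh \<phi>1 * cosh \<phi>2"

text \<open>\<open>tan_half_superposition P Q a s\<close> says \<open>tan (s/2) = (P - Q tan (a/2)) / (Q + P tan (a/2))\<close>,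
  where both sides are read in \<open>\<real> \<union> {\<infinity>}\<close>, since \<^const>\<open>tan\<close> and division are total and give the
  value \<open>0\<close> instead of \<open>\<infinity>\<close>. When \<open>tan (a/2) = \<infinity>\<close> the right-hand side is \<open>- Q / P\<close>.
  It is meant for \<open>(P, Q) \<noteq> (0, 0)\<close>, which holds for \<^const>\<open>P_tilde\<close>, \<^const>\<open>Q_tilde\<close>
  when \<open>\<phi>1 \<noteq> \<phi>2\<close> are nonnegative.\<close>

definition tan_half_superposition :: "real \<Rightarrow> real \<Rightarrow> real \<Rightarrow> real \<Rightarrow> bool" where
  "tan_half_superposition P Q a s \<longleftrightarrow>
     (if cos (a / 2) \<noteq> 0 then
        if Q + P * tan (a / 2) \<noteq> 0
        then cos (s / 2) \<noteq> 0 \<and> tan (s / 2) = (P - Q * tan (a / 2)) / (Q + P * tan (a / 2))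
        else cos (s / 2) = 0
      else
        if P \<noteq> 0 then cos (s / 2) \<noteq> 0 \<and> tan (s / 2) = - Q / P
        else cos (s / 2) = 0)"

text \<open>Two facts about uniqueness of \<open>\<alpha>*\<close>. First, the transformation \<open>\<B>\<^sup>0\<close> and the sine-Gordon
  equation are invariant under \<open>\<beta>' \<mapsto> \<beta>' + 4\<pi>\<close>, so uniqueness is up to constants in \<open>4\<pi>\<int>\<close>.
  Second, if \<open>\<alpha>'' = - \<alpha>'\<close> identically, then \<open>\<alpha> + 2\<pi>\<close> is itself a solution
  associated to both \<open>\<alpha>'\<close> and \<open>\<alpha>''\<close>, and in general it does not satisfy the tangent formula.
  With \<open>\<alpha> = \<alpha>' = \<alpha>'' = 0\<close>, for instance, both constants \<open>0\<close> and \<open>2\<pi>\<close> are associated. This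
  case is the only exception to uniqueness.\<close>

end

theory Submission
  imports Defs
begin

text \<open>
  The proof puts \<open>\<alpha>s = 4 arctan (\<kappa> tanh ((\<alpha>'' - \<alpha>') / 4)) - \<alpha>\<close>, where
  \<open>\<kappa> = \<tau> (sinh \<phi>1 - sinh \<phi>2) / (cosh \<phi>1 cosh \<phi>2 - 1 - sinh \<phi>1 sinh \<phi>2)\<close>. This \<open>\<alpha>s\<close> is the sum of \<open>- \<alpha>\<close> and a
  single smooth function of \<open>\<alpha>'' - \<alpha>'\<close>, so it is globally defined and twice continuously
  differentiable on \<open>U\<close>, whatever the topology of \<open>U\<close>: the tangent formula fixes an angle only modulo \<open>\<pi>\<close>,
  but the vector \<open>(Q, P)\<close> never meets the nonnegative first axis (\<open>P = 0\<close> forces \<open>\<alpha>'' = \<alpha>'\<close>, and then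
  \<open>Q < 0\<close>), so that its argument has a continuous branch, and this is what the arctangent expresses.

  The parameters enter only through the Gudermannian angles \<open>\<psi>\<^sub>i\<close> with \<open>cos \<psi>\<^sub>i = 1 / cosh \<phi>\<^sub>i\<close> and
  \<open>sin \<psi>\<^sub>i = tanh \<phi>\<^sub>i\<close>. Rotating \<open>\<psi>\<^sub>2\<close> by \<open>\<psi>\<^sub>1 - \<psi>\<^sub>2\<close>, and passing from \<open>\<alpha>'/2\<close> to \<open>\<alpha>''/2\<close> by the addition
  theorems for \<open>sinh\<close> and \<open>cosh\<close>, makes the first transformation a polynomial identity
  (\<open>Baecklund0_identity\<close>); the second follows by interchanging \<open>(\<phi>1, \<alpha>')\<close> and
  \<open>(\<phi>2, \<alpha>'')\<close>. The sine-Gordon equation is obtained from the chain rule for the Laplacian: the transformations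
  \<open>\<B>\<^sup>1\<close> determine the gradient of \<open>\<alpha>'' - \<alpha>'\<close> algebraically, and the sinh-Gordon equations determine its
  Laplacian, so that again an algebraic identity remains (\<open>sine_Gordon_identity\<close>). In this way no
  mixed second derivatives have to be interchanged.

  For uniqueness, let \<open>\<beta>\<close> be associated to both \<open>\<alpha>'\<close> and \<open>\<alpha>''\<close>. The two expressions for each of \<open>\<beta>\<^sub>x\<^sub>1\<close> and
  \<open>\<beta>\<^sub>x\<^sub>2\<close> must agree, and both differences have a common factor
  (\<open>Baecklund_consistency_factor\<close>), which vanishes exactly when \<open>\<beta> \<equiv> \<alpha>s\<close> modulo \<open>4\<pi>\<close>. The two cofactors
  vanish together only when \<open>\<alpha>'' = - \<alpha>'\<close> and \<open>\<beta> \<equiv> \<alpha> + 2\<pi>\<close> modulo \<open>4\<pi>\<close>. So at each point \<open>\<beta>\<close> has one of two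
  values. That the same alternative holds throughout \<open>U\<close> is not a matter of continuity, because the two
  values may coincide somewhere; it holds since a transform of a given function is determined by
  its value at one point (\<open>Baecklund0_unique_continuation\<close>).
\<close>

section \<open>Partial derivatives of functions on an open subset of the plane\<close>

lemma C1_on_pd1:
  assumes "C1_on U u" "x \<in> U"
  shows "((\<lambda>t. u (t, snd x)) has_real_derivative pd1 u x) (at (fst x))"
  using assms
  by (auto simp: C1_on_def pd1_def DERIV_deriv_iff_real_differentiable)

lemma C1_on_pd2:
  assumes "C1_on U u" "x \<in> U"
  shows "((\<lambda>t. u (fst x, t)) has_real_derivative pd2 u x) (at (snd x))"
  using assms
  by (auto simp: C1_on_def pd2_def DERIV_deriv_iff_real_differentiable)

lemma pd1_eqI: "((\<lambda>t. u (t, snd x)) has_real_derivative p) (at (fst x)) \<Longrightarrow> pd1 u x = p"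
  unfolding pd1_def by (rule DERIV_imp_deriv)

lemma pd2_eqI: "((\<lambda>t. u (fst x, t)) has_real_derivative q) (at (snd x)) \<Longrightarrow> pd2 u x = q"
  unfolding pd2_def by (rule DERIV_imp_deriv)

lemma C1_onI:
  assumes p: "\<And>x. x \<in> U \<Longrightarrow> ((\<lambda>t. u (t, snd x)) has_real_derivative p x) (at (fst x))"
    and q: "\<And>x. x \<in> U \<Longrightarrow> ((\<lambda>t. u (fst x, t)) has_real_derivative q x) (at (snd x))"
    and cont: "continuous_on U p" "continuous_on U q"
  shows "C1_on U u"
proof -
  have "continuous_on U (pd1 u) \<longleftrightarrow> continuous_on U p"
    by (intro continuous_on_cong refl pd1_eqI p)
  moreover have "continuous_on U (pd2 u) \<longleftrightarrow> continuous_on U q"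
    by (intro continuous_on_cong refl pd2_eqI q)
  moreover have "(\<lambda>t. u (t, snd x)) differentiable (at (fst x))"
    "(\<lambda>t. u (fst x, t)) differentiable (at (snd x))" if "x \<in> U" for x
    using p[OF that] q[OF that] real_differentiable_def by blast+
  ultimately show ?thesis
    using cont by (simp add: C1_on_def)
qed

lemma eventually_horizontal:
  assumes "open U" "x \<in> U"
  shows "\<forall>\<^sub>F t in nhds (fst x). (t, snd x) \<in> U"
proof -
  have "open ((\<lambda>t. (t, snd x)) -` U)"
    by (intro open_vimage assms continuous_intros)
  from eventually_nhds_in_open[OF this, of "fst x"] show ?thesis
    using assms(2) by simp
qed

lemma eventually_vertical:
  assumes "open U" "x \<in> U"
  shows "\<forall>\<^sub>F t in nhds (snd x). (fst x, t) \<in> U"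
proof -
  have "open ((\<lambda>t. (fst x, t)) -` U)"
    by (intro open_vimage assms continuous_intros)
  from eventually_nhds_in_open[OF this, of "snd x"] show ?thesis
    using assms(2) by simp
qed

lemma pd1_cong:
  assumes "open U" "x \<in> U" "\<And>y. y \<in> U \<Longrightarrow> u y = v y"
  shows "pd1 u x = pd1 v x"
  unfolding pd1_def
  by (intro deriv_cong_ev eventually_mono[OF eventually_horizontal[OF assms(1,2)]] refl assms(3))

lemma pd2_cong:
  assumes "open U" "x \<in> U" "\<And>y. y \<in> U \<Longrightarrow> u y = v y"
  shows "pd2 u x = pd2 v x"
  unfolding pd2_def
  by (intro deriv_cong_ev eventually_mono[OF eventually_vertical[OF assms(1,2)]] refl assms(3))

lemma C1_on_cong:
  assumes "open U" "C1_on U u" "\<And>y. y \<in> U \<Longrightarrow> v y = u y"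
  shows "C1_on U v"
proof (rule C1_onI[of U v "pd1 u" "pd2 u"])
  fix x assume x: "x \<in> U"
  show "((\<lambda>t. v (t, snd x)) has_real_derivative pd1 u x) (at (fst x))"
  proof -
    have "\<forall>\<^sub>F t in nhds (fst x). v (t, snd x) = u (t, snd x)"
      by (rule eventually_mono[OF eventually_horizontal[OF assms(1) x]]) (rule assms(3))
    from DERIV_cong_ev[OF refl this refl] show ?thesis
      using C1_on_pd1[OF assms(2) x] by blast
  qed
  show "((\<lambda>t. v (fst x, t)) has_real_derivative pd2 u x) (at (snd x))"
  proof -
    have "\<forall>\<^sub>F t in nhds (snd x). v (fst x, t) = u (fst x, t)"
      by (rule eventually_mono[OF eventually_vertical[OF assms(1) x]]) (rule assms(3))
    from DERIV_cong_ev[OF refl this refl] show ?thesis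
      using C1_on_pd2[OF assms(2) x] by blast
  qed
qed (use assms(2) in \<open>auto simp: C1_on_def\<close>)

text \<open>Existence of the partial derivatives alone gives no continuity in both variables jointly;
  the continuity of the partial derivatives yields total differentiability.\<close>

lemma C1_on_imp_continuous_on:
  assumes U: "open U" and u: "C1_on U u"
  shows "continuous_on U u"
proof -
  have "isCont u x" if x: "x \<in> U" for x
  proof -
    obtain A B where AB: "open A" "open B" "x \<in> A \<times> B" "A \<times> B \<subseteq> U"
      using open_prod_elim[OF U x] by metis
    obtain e where e: "0 < e" "ball (snd x) e \<subseteq> B"
      using AB(2,3) open_contains_ball by (metis mem_Times_iff)
    define B' where "B' = ball (snd x) e"
    have sub: "A \<times> B' \<subseteq> U"
      using AB(4) e(2) by (auto simp: B'_def)
    have fx: "((\<lambda>s. u (s, snd x)) has_derivative (*) (pd1 u x)) (at (fst x) within A)"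
      using C1_on_pd1[OF u x] unfolding has_field_derivative_def by (rule has_derivative_at_withinI)
    have apply_scaleR: "blinfun_apply (blinfun_scaleR_left c) = (*) c" for c :: real
      by (simp add: fun_eq_iff mult.commute)
    have fy: "((\<lambda>t. u (s, t)) has_derivative
        blinfun_apply (blinfun_scaleR_left (pd2 u (s, t)))) (at t within B')"
      if "s \<in> A" "t \<in> B'" for s t
    proof -
      have "(s, t) \<in> U" using sub that by blast
      from C1_on_pd2[OF u this] show ?thesis
        unfolding has_field_derivative_def apply_scaleR fst_conv snd_conv
        by (rule has_derivative_at_withinI)
    qed
    have "continuous_on (A \<times> B') (pd2 u)"
      using u sub continuous_on_subset unfolding C1_on_def by blast
    then have "continuous_on (A \<times> B') (\<lambda>y. blinfun_scaleR_left (pd2 u y))"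
      by (intro continuous_intros)
    moreover have "(\<lambda>(s, t). blinfun_scaleR_left (pd2 u (s, t))) = (\<lambda>y. blinfun_scaleR_left (pd2 u y))"
      by auto
    ultimately have cont: "continuous (at (fst x, snd x) within A \<times> B') (\<lambda>(s, t). blinfun_scaleR_left (pd2 u (s, t)))"
      using AB(3) e(1) by (auto simp: continuous_on_eq_continuous_within B'_def)
    have "((\<lambda>(s, t). u (s, t)) has_derivative
        (\<lambda>(tx, ty). pd1 u x * tx + blinfun_apply (blinfun_scaleR_left (pd2 u (fst x, snd x))) ty))
        (at (fst x, snd x) within A \<times> B')"
      by (rule has_derivative_partialsI[OF fx fy cont])
         (use AB(3) e(1) in \<open>auto simp: B'_def\<close>)
    from has_derivative_continuous[OF this] have "continuous (at x within A \<times> B') u"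
      by (simp add: case_prod_eta)
    moreover have "at x within A \<times> B' = at x"
      using AB e(1) by (intro at_within_open open_Times) (auto simp: B'_def mem_Times_iff)
    ultimately show ?thesis by simp
  qed
  then show ?thesis
    by (simp add: continuous_at_imp_continuous_on)
qed

lemma pd1_compose:
  assumes "C1_on U u" "x \<in> U" "\<And>s. (f has_real_derivative f' s) (at s)"
  shows "((\<lambda>t. f (u (t, snd x))) has_real_derivative f' (u x) * pd1 u x) (at (fst x))"
proof (rule DERIV_chain2[OF _ C1_on_pd1[OF assms(1,2)]])
  show "(f has_real_derivative f' (u x)) (at (u (fst x, snd x)))"
    using assms(3) by simp
qed

lemma pd2_compose:
  assumes "C1_on U u" "x \<in> U" "\<And>s. (f has_real_derivative f' s) (at s)"
  shows "((\<lambda>t. f (u (fst x, t))) has_real_derivative f' (u x) * pd2 u x) (at (snd x))"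
proof (rule DERIV_chain2[OF _ C1_on_pd2[OF assms(1,2)]])
  show "(f has_real_derivative f' (u x)) (at (u (fst x, snd x)))"
    using assms(3) by simp
qed

lemma C1_on_compose:
  assumes U: "open U" and u: "C1_on U u"
    and f: "\<And>s. (f has_real_derivative f' s) (at s)" and f': "continuous_on UNIV f'"
  shows "C1_on U (\<lambda>x. f (u x))"
proof (rule C1_onI)
  fix x assume x: "x \<in> U"
  show "((\<lambda>t. f (u (t, snd x))) has_real_derivative f' (u x) * pd1 u x) (at (fst x))"
    by (rule pd1_compose[OF u x]) (rule f)
  show "((\<lambda>t. f (u (fst x, t))) has_real_derivative f' (u x) * pd2 u x) (at (snd x))"
    by (rule pd2_compose[OF u x]) (rule f)
next
  have "continuous_on U (\<lambda>x. f' (u x))"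
    by (rule continuous_on_compose2[OF f' C1_on_imp_continuous_on[OF U u]]) simp
  then show "continuous_on U (\<lambda>x. f' (u x) * pd1 u x)" "continuous_on U (\<lambda>x. f' (u x) * pd2 u x)"
    using u unfolding C1_on_def by (simp_all add: continuous_on_mult)
qed

lemma pd_diff:
  assumes "C1_on U u" "C1_on U v" "x \<in> U"
  shows pd1_diff: "pd1 (\<lambda>x. u x - v x) x = pd1 u x - pd1 v x"
    and pd2_diff: "pd2 (\<lambda>x. u x - v x) x = pd2 u x - pd2 v x"
  by (rule pd1_eqI[OF DERIV_diff[OF C1_on_pd1[OF assms(1,3)] C1_on_pd1[OF assms(2,3)]]])
     (rule pd2_eqI[OF DERIV_diff[OF C1_on_pd2[OF assms(1,3)] C1_on_pd2[OF assms(2,3)]]])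

lemma C1_on_diff:
  assumes "C1_on U u" "C1_on U v"
  shows "C1_on U (\<lambda>x. u x - v x)"
proof (rule C1_onI[where p = "\<lambda>x. pd1 u x - pd1 v x" and q = "\<lambda>x. pd2 u x - pd2 v x"])
  fix x assume x: "x \<in> U"
  show "((\<lambda>t. u (t, snd x) - v (t, snd x)) has_real_derivative pd1 u x - pd1 v x) (at (fst x))"
    by (rule DERIV_diff[OF C1_on_pd1[OF assms(1) x] C1_on_pd1[OF assms(2) x]])
  show "((\<lambda>t. u (fst x, t) - v (fst x, t)) has_real_derivative pd2 u x - pd2 v x) (at (snd x))"
    by (rule DERIV_diff[OF C1_on_pd2[OF assms(1) x] C1_on_pd2[OF assms(2) x]])
qed (use assms in \<open>auto simp: C1_on_def intro: continuous_on_diff\<close>)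

lemma pd_mult:
  assumes "C1_on U u" "C1_on U v" "x \<in> U"
  shows pd1_mult: "pd1 (\<lambda>x. u x * v x) x = pd1 u x * v x + pd1 v x * u x"
    and pd2_mult: "pd2 (\<lambda>x. u x * v x) x = pd2 u x * v x + pd2 v x * u x"
  using pd1_eqI[OF DERIV_mult[OF C1_on_pd1[OF assms(1,3)] C1_on_pd1[OF assms(2,3)]]]
    pd2_eqI[OF DERIV_mult[OF C1_on_pd2[OF assms(1,3)] C1_on_pd2[OF assms(2,3)]]]
  by simp_all

lemma C1_on_mult:
  assumes "open U" "C1_on U u" "C1_on U v"
  shows "C1_on U (\<lambda>x. u x * v x)"
proof (rule C1_onI[where p = "\<lambda>x. pd1 u x * v x + pd1 v x * u x"
      and q = "\<lambda>x. pd2 u x * v x + pd2 v x * u x"])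
  fix x assume x: "x \<in> U"
  show "((\<lambda>t. u (t, snd x) * v (t, snd x)) has_real_derivative
      pd1 u x * v x + pd1 v x * u x) (at (fst x))"
    using DERIV_mult[OF C1_on_pd1[OF assms(2) x] C1_on_pd1[OF assms(3) x]]
    by (simp only: prod.collapse)
  show "((\<lambda>t. u (fst x, t) * v (fst x, t)) has_real_derivative
      pd2 u x * v x + pd2 v x * u x) (at (snd x))"
    using DERIV_mult[OF C1_on_pd2[OF assms(2) x] C1_on_pd2[OF assms(3) x]]
    by (simp only: prod.collapse)
next
  have "continuous_on U u" "continuous_on U v"
    by (rule C1_on_imp_continuous_on[OF assms(1,2)] C1_on_imp_continuous_on[OF assms(1,3)])+
  moreover have "continuous_on U (pd1 u)" "continuous_on U (pd2 u)" "continuous_on U (pd1 v)" "continuous_on U (pd2 v)"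
    using assms by (simp_all add: C1_on_def)
  ultimately show "continuous_on U (\<lambda>x. pd1 u x * v x + pd1 v x * u x)"
    "continuous_on U (\<lambda>x. pd2 u x * v x + pd2 v x * u x)"
    by (simp_all add: continuous_on_add continuous_on_mult)
qed

lemma C2_on_diff:
  assumes U: "open U" and u: "C2_on U u" and v: "C2_on U v"
  shows "C2_on U (\<lambda>x. u x - v x)"
    and "x \<in> U \<Longrightarrow> pd1 (pd1 (\<lambda>x. u x - v x)) x + pd2 (pd2 (\<lambda>x. u x - v x)) x =
      (pd1 (pd1 u) x + pd2 (pd2 u) x) - (pd1 (pd1 v) x + pd2 (pd2 v) x)"
proof -
  have C1: "C1_on U u" "C1_on U (pd1 u)" "C1_on U (pd2 u)"
    "C1_on U v" "C1_on U (pd1 v)" "C1_on U (pd2 v)"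
    using u v by (auto simp: C2_on_def)
  let ?w = "\<lambda>x. u x - v x"
  have p: "pd1 ?w y = pd1 u y - pd1 v y" "pd2 ?w y = pd2 u y - pd2 v y" if "y \<in> U" for y
    using pd_diff[OF C1(1,4) that] .
  have "C1_on U (pd1 ?w)" "C1_on U (pd2 ?w)"
    by (rule C1_on_cong[OF U C1_on_diff[OF C1(2,5)]], erule p(1),
        rule C1_on_cong[OF U C1_on_diff[OF C1(3,6)]], erule p(2))
  then show "C2_on U ?w"
    using C1_on_diff[OF C1(1,4)] by (simp add: C2_on_def)
  assume x: "x \<in> U"
  have "pd1 (pd1 ?w) x = pd1 (\<lambda>y. pd1 u y - pd1 v y) x"
    by (rule pd1_cong[OF U x]) (erule p(1))
  moreover have "pd2 (pd2 ?w) x = pd2 (\<lambda>y. pd2 u y - pd2 v y) x"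
    by (rule pd2_cong[OF U x]) (erule p(2))
  ultimately show "pd1 (pd1 ?w) x + pd2 (pd2 ?w) x =
      (pd1 (pd1 u) x + pd2 (pd2 u) x) - (pd1 (pd1 v) x + pd2 (pd2 v) x)"
    by (simp add: pd1_diff[OF C1(2,5) x] pd2_diff[OF C1(3,6) x])
qed

text \<open>For \<open>u = \<alpha>'' - \<alpha>'\<close> the gradient and the Laplacian on the right-hand side are both known
  algebraically, the former from the transformations and the latter from the field equations.\<close>

lemma C2_on_compose:
  assumes U: "open U" and u: "C2_on U u"
    and f: "\<And>s. (f has_real_derivative f' s) (at s)"
    and f': "\<And>s. (f' has_real_derivative f'' s) (at s)"
    and f'': "continuous_on UNIV f''"
  shows "C2_on U (\<lambda>x. f (u x))"
    and "x \<in> U \<Longrightarrow> pd1 (pd1 (\<lambda>x. f (u x))) x + pd2 (pd2 (\<lambda>x. f (u x))) x =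
      f'' (u x) * ((pd1 u x)\<^sup>2 + (pd2 u x)\<^sup>2) + f' (u x) * (pd1 (pd1 u) x + pd2 (pd2 u) x)"
proof -
  have C1: "C1_on U u" "C1_on U (pd1 u)" "C1_on U (pd2 u)"
    using u by (auto simp: C2_on_def)
  have contf': "continuous_on UNIV f'"
    using f' by (intro DERIV_continuous_on) (auto intro: has_field_derivative_at_within)
  let ?w = "\<lambda>x. f (u x)" and ?d = "\<lambda>x. f' (u x)"
  have p: "pd1 ?w y = ?d y * pd1 u y" "pd2 ?w y = ?d y * pd2 u y" if "y \<in> U" for y
    by (rule pd1_eqI, rule pd1_compose[OF C1(1) that], rule f)
       (rule pd2_eqI, rule pd2_compose[OF C1(1) that], rule f)
  have d: "C1_on U ?d"
    by (rule C1_on_compose[OF U C1(1) _ f'']) (rule f')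
  have "C1_on U ?w"
    by (rule C1_on_compose[OF U C1(1) _ contf']) (rule f)
  moreover have "C1_on U (pd1 ?w)" "C1_on U (pd2 ?w)"
    by (rule C1_on_cong[OF U C1_on_mult[OF U d C1(2)]], erule p(1),
        rule C1_on_cong[OF U C1_on_mult[OF U d C1(3)]], erule p(2))
  ultimately show "C2_on U ?w"
    by (simp add: C2_on_def)
  assume x: "x \<in> U"
  have "pd1 (pd1 ?w) x = pd1 (\<lambda>y. ?d y * pd1 u y) x"
    by (rule pd1_cong[OF U x]) (erule p(1))
  moreover have "pd2 (pd2 ?w) x = pd2 (\<lambda>y. ?d y * pd2 u y) x"
    by (rule pd2_cong[OF U x]) (erule p(2))
  moreover have "pd1 ?d x = f'' (u x) * pd1 u x" "pd2 ?d x = f'' (u x) * pd2 u x"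
    by (rule pd1_eqI, rule pd1_compose[OF C1(1) x], rule f')
       (rule pd2_eqI, rule pd2_compose[OF C1(1) x], rule f')
  ultimately show "pd1 (pd1 ?w) x + pd2 (pd2 ?w) x =
      f'' (u x) * ((pd1 u x)\<^sup>2 + (pd2 u x)\<^sup>2) + f' (u x) * (pd1 (pd1 u) x + pd2 (pd2 u) x)"
    by (simp only: pd1_mult[OF d C1(2) x] pd2_mult[OF d C1(3) x]) (simp add: power2_eq_square algebra_simps)
qed

section \<open>Unique continuation for the transformation\<close>

text \<open>The weighted square \<open>g\<^sup>2 exp (- 2 L t)\<close> is nonincreasing, so that a zero of \<open>g\<close> spreads to the right;
  the weight \<open>exp (2 L t)\<close> spreads it to the left.\<close>

lemma linear_bound_zero:
  fixes g g' :: "real \<Rightarrow> real"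
  assumes der: "\<And>t. t \<in> closed_segment a b \<Longrightarrow> (g has_real_derivative g' t) (at t)"
    and bound: "\<And>t. t \<in> closed_segment a b \<Longrightarrow> \<bar>g' t\<bar> \<le> L * \<bar>g t\<bar>"
    and "g a = 0"
  shows "g b = 0"
proof -
  have est: "\<bar>2 * g t * g' t\<bar> \<le> 2 * L * (g t)\<^sup>2" if "t \<in> closed_segment a b" for t
  proof -
    have "\<bar>2 * g t * g' t\<bar> = 2 * \<bar>g t\<bar> * \<bar>g' t\<bar>"
      by (simp add: abs_mult)
    also have "\<dots> \<le> 2 * \<bar>g t\<bar> * (L * \<bar>g t\<bar>)"
      by (intro mult_left_mono bound[OF that]) simp
    also have "\<dots> = 2 * L * \<bar>g t\<bar>\<^sup>2"
      by (simp only: power2_eq_square mult_ac)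
    finally show ?thesis by simp
  qed
  have "(g b)\<^sup>2 \<le> 0"
  proof (cases "a \<le> b")
    case True
    let ?h = "\<lambda>t. (g t)\<^sup>2 * exp (- (2 * L * t))"
    have "?h b \<le> ?h a"
    proof (rule DERIV_nonpos_imp_nonincreasing[OF True])
      fix t assume "a \<le> t" "t \<le> b"
      then have t: "t \<in> closed_segment a b"
        using True by (simp add: closed_segment_eq_real_ivl)
      have "(?h has_real_derivative (2 * g t * g' t - 2 * L * (g t)\<^sup>2) * exp (- (2 * L * t))) (at t)"
        by (auto intro!: derivative_eq_intros der[OF t] simp: algebra_simps power2_eq_square)
      moreover have "(2 * g t * g' t - 2 * L * (g t)\<^sup>2) * exp (- (2 * L * t)) \<le> 0"
        using est[OF t] by (intro mult_nonpos_nonneg) auto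
      ultimately show "\<exists>y. (?h has_real_derivative y) (at t) \<and> y \<le> 0" by blast
    qed
    then show ?thesis
      using \<open>g a = 0\<close> by (simp add: mult_le_0_iff)
  next
    case False
    let ?h = "\<lambda>t. (g t)\<^sup>2 * exp (2 * L * t)"
    have "?h b \<le> ?h a"
    proof (rule DERIV_nonneg_imp_nondecreasing[where f = ?h])
      show "b \<le> a" using False by simp
      fix t assume "b \<le> t" "t \<le> a"
      then have t: "t \<in> closed_segment a b"
        using False by (simp add: closed_segment_eq_real_ivl)
      have "(?h has_real_derivative (2 * g t * g' t + 2 * L * (g t)\<^sup>2) * exp (2 * L * t)) (at t)"
        by (auto intro!: derivative_eq_intros der[OF t] simp: algebra_simps power2_eq_square)
      moreover have "(2 * g t * g' t + 2 * L * (g t)\<^sup>2) * exp (2 * L * t) \<ge> 0"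
        using est[OF t] by (intro mult_nonneg_nonneg) auto
      ultimately show "\<exists>y. (?h has_real_derivative y) (at t) \<and> y \<ge> 0" by blast
    qed
    then show ?thesis
      using \<open>g a = 0\<close> by (simp add: mult_le_0_iff)
  qed
  then show ?thesis by simp
qed

text \<open>In a small box the bound has a constant factor, and any two points of the box are joined by a
  horizontal and a vertical segment. A zero therefore spreads over the box, and from box to box
  over the connected set.\<close>

lemma linear_bound_zero_connected:
  assumes U: "open U" "connected U" and M: "continuous_on U M"
    and g: "C1_on U g"
    and bound: "\<And>x. x \<in> U \<Longrightarrow> \<bar>pd1 g x\<bar> \<le> M x * \<bar>g x\<bar>" "\<And>x. x \<in> U \<Longrightarrow> \<bar>pd2 g x\<bar> \<le> M x * \<bar>g x\<bar>"
    and zero: "x0 \<in> U" "g x0 = 0" and x: "x \<in> U"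
  shows "g x = 0"
proof (rule connected_induction_simple[where P = "\<lambda>x. g x = 0", OF U(2) zero(1) x zero(2)])
  fix z assume z: "z \<in> U"
  let ?V = "U \<inter> M -` {..< M z + 1}"
  have "open ?V"
    by (rule continuous_open_preimage[OF M U(1) open_lessThan])
  then obtain A B where AB: "open A" "open B" "z \<in> A \<times> B" "A \<times> B \<subseteq> ?V"
    by (rule open_prod_elim[of ?V z]) (use z in auto)
  obtain e where e: "0 < e" "ball (fst z) e \<subseteq> A"
    using AB(1,3) open_contains_ball by (metis mem_Times_iff)
  obtain e' where e': "0 < e'" "ball (snd z) e' \<subseteq> B"
    using AB(2,3) open_contains_ball by (metis mem_Times_iff)
  let ?T = "ball (fst z) e \<times> ball (snd z) e'"
  have T: "?T \<subseteq> ?V"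
    using AB(4) e(2) e'(2) by blast
  have est: "\<bar>pd1 g w\<bar> \<le> (M z + 1) * \<bar>g w\<bar>" "\<bar>pd2 g w\<bar> \<le> (M z + 1) * \<bar>g w\<bar>" "w \<in> U" if "w \<in> ?T" for w
  proof -
    have w: "w \<in> U" "M w \<le> M z + 1" using T that by auto
    then have "M w * \<bar>g w\<bar> \<le> (M z + 1) * \<bar>g w\<bar>"
      by (intro mult_right_mono) auto
    then show "\<bar>pd1 g w\<bar> \<le> (M z + 1) * \<bar>g w\<bar>" "\<bar>pd2 g w\<bar> \<le> (M z + 1) * \<bar>g w\<bar>" "w \<in> U"
      using bound[OF w(1)] w(1) by linarith+
  qed
  have "g y = 0" if y: "y \<in> ?T" and w: "w \<in> ?T" and "g w = 0" for y w
  proof -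
    have seg1: "(t, snd w) \<in> ?T" if "t \<in> closed_segment (fst w) (fst y)" for t
    proof -
      have "t \<in> ball (fst z) e"
        using that closed_segment_subset[of "fst w" "ball (fst z) e" "fst y"] y w
        by (auto simp only: mem_Times_iff convex_ball)
      then show ?thesis using y w by (simp add: mem_Times_iff)
    qed
    have seg2: "(fst y, t) \<in> ?T" if "t \<in> closed_segment (snd w) (snd y)" for t
    proof -
      have "t \<in> ball (snd z) e'"
        using that closed_segment_subset[of "snd w" "ball (snd z) e'" "snd y"] y w
        by (auto simp only: mem_Times_iff convex_ball)
      then show ?thesis using y w by (simp add: mem_Times_iff)
    qed
    have "g (fst y, snd w) = 0"
      using est(1,3)[OF seg1] C1_on_pd1[OF g est(3)[OF seg1]] \<open>g w = 0\<close>
      by (intro linear_bound_zero[of "fst w" "fst y" "\<lambda>t. g (t, snd w)" "\<lambda>t. pd1 g (t, snd w)" "M z + 1"])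
         auto
    then have "g (fst y, snd y) = 0"
      using est(2,3)[OF seg2] C1_on_pd2[OF g est(3)[OF seg2]]
      by (intro linear_bound_zero[of "snd w" "snd y" "\<lambda>t. g (fst y, t)" "\<lambda>t. pd2 g (fst y, t)" "M z + 1"])
         auto
    then show ?thesis by simp
  qed
  moreover have "openin (top_of_set U) ?T"
    using T by (intro open_openin_trans U(1) open_Times open_ball) auto
  moreover have "z \<in> ?T"
    using e e' by (auto simp: mem_Times_iff)
  ultimately show "\<exists>T. openin (top_of_set U) T \<and> z \<in> T \<and> (\<forall>x\<in>T. \<forall>y\<in>T. g x = 0 \<longrightarrow> g y = 0)"
    by blast
qed

lemma sin_cos_half_diff_le:
  fixes s t :: real
  shows "\<bar>sin (s / 2) - sin (t / 2)\<bar> \<le> \<bar>s - t\<bar>" "\<bar>cos (s / 2) - cos (t / 2)\<bar> \<le> \<bar>s - t\<bar>"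
proof -
  have *: "\<bar>sin u\<bar> * \<bar>v\<bar> \<le> \<bar>u\<bar>" if "\<bar>v\<bar> \<le> 1" for u v :: real
    using mult_mono[OF abs_sin_x_le_abs_x that, of u] by simp
  show "\<bar>sin (s / 2) - sin (t / 2)\<bar> \<le> \<bar>s - t\<bar>"
    using *[of "cos ((s / 2 + t / 2) / 2)" "(s / 2 - t / 2) / 2"]
    unfolding sin_diff_sin abs_mult by (auto simp: mult.assoc)
  show "\<bar>cos (s / 2) - cos (t / 2)\<bar> \<le> \<bar>s - t\<bar>"
    using *[of "sin ((s / 2 + t / 2) / 2)" "(t / 2 - s / 2) / 2"]
    unfolding cos_diff_cos abs_mult by (auto simp: mult_ac)
qed

text \<open>With \<open>a\<close> given, the transformation prescribes both partial derivatives of the transform as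
  functions of its value that are Lipschitz, locally uniformly in the point. The difference of two
  transforms hence satisfies a linear bound.\<close>

lemma Baecklund0_unique_continuation:
  assumes U: "open U" "connected U"
    and a: "C1_on U a" and u: "C1_on U u" and v: "C1_on U v"
    and Bu: "Baecklund0 \<tau> \<phi> U a u" and Bv: "Baecklund0 \<tau> \<phi> U a v"
    and x0: "x0 \<in> U" "u x0 = v x0" and x: "x \<in> U"
  shows "u x = v x"
proof -
  define K where "K = \<bar>2 / cosh \<phi>\<bar>"
  define N where "N = \<bar>2 * \<tau> * sinh \<phi> / cosh \<phi>\<bar>"
  define M where "M = (\<lambda>x. (K + N) * (\<bar>cosh (a x / 2)\<bar> + \<bar>sinh (a x / 2)\<bar>))"
  have KN: "K \<ge> 0" "N \<ge> 0" by (auto simp: K_def N_def)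
  let ?g = "\<lambda>x. u x - v x"
  have key: "\<bar>c1 * h + c2 * k\<bar> \<le> (K + N) * (\<bar>X\<bar> + \<bar>Y\<bar>) * e"
    if "\<bar>c1\<bar> \<le> K * e" "\<bar>c2\<bar> \<le> N * e" "\<bar>h\<bar> \<le> \<bar>X\<bar> + \<bar>Y\<bar>" "\<bar>k\<bar> \<le> \<bar>X\<bar> + \<bar>Y\<bar>" "0 \<le> e"
    for c1 c2 h k X Y e :: real
  proof -
    have "\<bar>c1 * h\<bar> \<le> K * e * (\<bar>X\<bar> + \<bar>Y\<bar>)" "\<bar>c2 * k\<bar> \<le> N * e * (\<bar>X\<bar> + \<bar>Y\<bar>)"
      unfolding abs_mult using that KN by (auto intro!: mult_mono)
    then show ?thesis
      using abs_triangle_ineq[of "c1 * h" "c2 * k"] by (simp add: algebra_simps)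
  qed
  have "?g x = 0"
  proof (rule linear_bound_zero_connected[where g = ?g and M = M, OF U _ C1_on_diff[OF u v]])
    show "continuous_on U M"
      unfolding M_def using C1_on_imp_continuous_on[OF U(1) a] by (intro continuous_intros) simp_all
    show "x0 \<in> U" "?g x0 = 0" "x \<in> U" using x0 x by auto
    fix y assume y: "y \<in> U"
    let ?s = "sin (u y / 2) - sin (v y / 2)" and ?c = "cos (u y / 2) - cos (v y / 2)"
    let ?K = "2 / cosh \<phi>" and ?N = "2 * \<tau> * sinh \<phi> / cosh \<phi>"
    have eu: "pd1 u y - pd2 a y = ?K * sin (u y / 2) * cosh (a y / 2) + ?N * cos (u y / 2) * sinh (a y / 2)"
      "pd2 u y + pd1 a y = - ?K * cos (u y / 2) * sinh (a y / 2) + ?N * sin (u y / 2) * cosh (a y / 2)"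
      using Bu y by (auto simp: Baecklund0_def)
    have ev: "pd1 v y - pd2 a y = ?K * sin (v y / 2) * cosh (a y / 2) + ?N * cos (v y / 2) * sinh (a y / 2)"
      "pd2 v y + pd1 a y = - ?K * cos (v y / 2) * sinh (a y / 2) + ?N * sin (v y / 2) * cosh (a y / 2)"
      using Bv y by (auto simp: Baecklund0_def)
    have p1: "pd1 u y - pd1 v y = (?K * ?s) * cosh (a y / 2) + (?N * ?c) * sinh (a y / 2)"
      using eu(1) ev(1) by (simp only: algebra_simps)
    have p2: "pd2 u y - pd2 v y = (- ?K * ?c) * sinh (a y / 2) + (?N * ?s) * cosh (a y / 2)"
      using eu(2) ev(2) by (simp only: algebra_simps)
    have sc: "\<bar>?s\<bar> \<le> \<bar>?g y\<bar>" "\<bar>?c\<bar> \<le> \<bar>?g y\<bar>"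
      by (rule sin_cos_half_diff_le)+
    have bd: "\<bar>?K * ?s\<bar> \<le> K * \<bar>?g y\<bar>" "\<bar>- ?K * ?c\<bar> \<le> K * \<bar>?g y\<bar>"
      "\<bar>?N * ?s\<bar> \<le> N * \<bar>?g y\<bar>" "\<bar>?N * ?c\<bar> \<le> N * \<bar>?g y\<bar>"
      unfolding K_def N_def abs_mult abs_minus_cancel using sc
      by (intro mult_mono mult_nonneg_nonneg order.refl abs_ge_zero; simp)+
    show "\<bar>pd1 ?g y\<bar> \<le> M y * \<bar>?g y\<bar>"
      unfolding pd1_diff[OF u v y] p1 M_def by (rule key[OF bd(1,4)]) auto
    show "\<bar>pd2 ?g y\<bar> \<le> M y * \<bar>?g y\<bar>"
      unfolding pd2_diff[OF u v y] p2 M_def by (rule key[OF bd(2,3)]) auto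
  qed
  then show ?thesis by simp
qed

section \<open>The superposition formula as an algebraic identity\<close>

text \<open>With \<open>\<psi>\<^sub>i\<close> the Gudermannian angle of \<open>\<phi>\<^sub>i\<close>, that is \<open>cos \<psi>\<^sub>i = 1 / cosh \<phi>\<^sub>i\<close> and \<open>sin \<psi>\<^sub>i = tanh \<phi>\<^sub>i\<close>, the
  following two quantities are \<open>cos (\<psi>\<^sub>1 - \<psi>\<^sub>2)\<close> and \<open>sin (\<psi>\<^sub>1 - \<psi>\<^sub>2)\<close>.\<close>

definition gd_cos :: "real \<Rightarrow> real \<Rightarrow> real" where
  "gd_cos \<phi>1 \<phi>2 = (1 + sinh \<phi>1 * sinh \<phi>2) / (cosh \<phi>1 * cosh \<phi>2)"

definition gd_sin :: "real \<Rightarrow> real \<Rightarrow> real" where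
  "gd_sin \<phi>1 \<phi>2 = (sinh \<phi>1 - sinh \<phi>2) / (cosh \<phi>1 * cosh \<phi>2)"

lemma gd_commute: "gd_cos \<phi>1 \<phi>2 = gd_cos \<phi>2 \<phi>1" "gd_sin \<phi>1 \<phi>2 = - gd_sin \<phi>2 \<phi>1"
  by (simp_all add: gd_cos_def gd_sin_def field_simps)

lemma gd_rotate:
  shows "1 / cosh \<phi>1 = gd_cos \<phi>1 \<phi>2 * (1 / cosh \<phi>2) - gd_sin \<phi>1 \<phi>2 * tanh \<phi>2"
    and "tanh \<phi>1 = gd_cos \<phi>1 \<phi>2 * tanh \<phi>2 + gd_sin \<phi>1 \<phi>2 * (1 / cosh \<phi>2)"
proof -
  have [simp]: "cosh \<phi>1 \<noteq> 0" "cosh \<phi>2 \<noteq> 0" by simp_all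
  have "cosh \<phi>2 * cosh \<phi>2 = 1 + sinh \<phi>2 * sinh \<phi>2"
    using cosh_square_eq[of \<phi>2] by (simp add: power2_eq_square)
  then show "1 / cosh \<phi>1 = gd_cos \<phi>1 \<phi>2 * (1 / cosh \<phi>2) - gd_sin \<phi>1 \<phi>2 * tanh \<phi>2"
    "tanh \<phi>1 = gd_cos \<phi>1 \<phi>2 * tanh \<phi>2 + gd_sin \<phi>1 \<phi>2 * (1 / cosh \<phi>2)"
    unfolding gd_cos_def gd_sin_def tanh_def
    by (simp_all add: divide_simps) (simp_all add: algebra_simps)
qed

lemma gd_rotate_back:
  shows "1 / cosh \<phi>2 = gd_cos \<phi>1 \<phi>2 * (1 / cosh \<phi>1) + gd_sin \<phi>1 \<phi>2 * tanh \<phi>1"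
    and "tanh \<phi>2 = gd_cos \<phi>1 \<phi>2 * tanh \<phi>1 - gd_sin \<phi>1 \<phi>2 * (1 / cosh \<phi>1)"
  using gd_rotate[of \<phi>2 \<phi>1] by (simp_all add: gd_commute[of \<phi>2])

lemma gd_pythagoras: "(gd_cos \<phi>1 \<phi>2)\<^sup>2 + (gd_sin \<phi>1 \<phi>2)\<^sup>2 = 1"
proof -
  have "(1 + sinh \<phi>1 * sinh \<phi>2)\<^sup>2 + (sinh \<phi>1 - sinh \<phi>2)\<^sup>2 = (cosh \<phi>1 * cosh \<phi>2)\<^sup>2"
    unfolding power_mult_distrib cosh_square_eq by (simp add: power2_eq_square algebra_simps)
  then show ?thesis
    by (simp add: gd_cos_def gd_sin_def power_divide flip: add_divide_distrib)
qed

lemma gd_cos_less_1: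
  assumes "\<phi>1 \<noteq> \<phi>2"
  shows "gd_cos \<phi>1 \<phi>2 < 1"
proof -
  have "cosh (\<phi>1 - \<phi>2) > 1"
    using assms cosh_real_ge_1[of "\<phi>1 - \<phi>2"] cosh_real_one_iff[of "\<phi>1 - \<phi>2"] by linarith
  then show ?thesis
    by (simp add: gd_cos_def cosh_diff divide_less_eq_1)
qed

text \<open>The sum \<open>\<alpha>s + \<alpha>\<close> as a function of \<open>d = \<alpha>'' - \<alpha>'\<close>. In terms of the Gudermannian angles the
  coefficient of the hyperbolic tangent is \<open>\<tau> cot ((\<psi>\<^sub>1 - \<psi>\<^sub>2) / 2)\<close>.\<close>

definition superposition :: "real \<Rightarrow> real \<Rightarrow> real \<Rightarrow> real \<Rightarrow> real" where
  "superposition \<tau> \<phi>1 \<phi>2 d =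
     4 * arctan (\<tau> * gd_sin \<phi>1 \<phi>2 / (1 - gd_cos \<phi>1 \<phi>2) * tanh (d / 4))"

lemma superposition_commute: "superposition \<tau> \<phi>2 \<phi>1 (- d) = superposition \<tau> \<phi>1 \<phi>2 d"
  by (simp add: superposition_def gd_commute[of \<phi>2] minus_divide_left[symmetric])

lemma sin_cos_double_arctan:
  fixes x :: real
  shows "sin (2 * arctan x) = 2 * x / (1 + x\<^sup>2)" and "cos (2 * arctan x) = (1 - x\<^sup>2) / (1 + x\<^sup>2)"
proof -
  have "1 + x\<^sup>2 > 0"
    by (simp add: add_pos_nonneg)
  then show "sin (2 * arctan x) = 2 * x / (1 + x\<^sup>2)" "cos (2 * arctan x) = (1 - x\<^sup>2) / (1 + x\<^sup>2)"
    by (simp_all add: sin_double cos_double sin_arctan cos_arctan power_divide diff_divide_distrib)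
qed

lemma cosh_sinh_half:
  fixes d :: real
  shows "cosh (d / 2) = (cosh (d / 4))\<^sup>2 + (sinh (d / 4))\<^sup>2"
    and "sinh (d / 2) = 2 * sinh (d / 4) * cosh (d / 4)"
  using cosh_double[of "d / 4"] sinh_double[of "d / 4"] by simp_all

lemma gd_cos_less_cosh:
  assumes "\<phi>1 \<noteq> \<phi>2"
  shows "gd_cos \<phi>1 \<phi>2 < cosh s"
  using gd_cos_less_1[OF assms] cosh_real_ge_1[of s] by linarith

text \<open>The half-angle values are rational in \<open>C\<close> and \<open>S\<close> because
  \<open>\<kappa>\<^sup>2 = (1 + A) / (1 - A)\<close>, which turns \<open>1 + \<kappa>\<^sup>2 tanh\<^sup>2 (d / 4)\<close> into
  \<open>(C - A) / ((1 - A) cosh\<^sup>2 (d / 4))\<close>.\<close>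

lemma superposition_half:
  fixes d :: real
  assumes \<tau>: "\<tau>\<^sup>2 = 1" and \<phi>: "\<phi>1 \<noteq> \<phi>2"
  defines "A \<equiv> gd_cos \<phi>1 \<phi>2" and "D \<equiv> gd_sin \<phi>1 \<phi>2"
    and "C \<equiv> cosh (d / 2)" and "S \<equiv> sinh (d / 2)"
  shows "sin (superposition \<tau> \<phi>1 \<phi>2 d / 2) = \<tau> * D * S / (C - A)"
    and "cos (superposition \<tau> \<phi>1 \<phi>2 d / 2) = (1 - A * C) / (C - A)"
    and "(superposition \<tau> \<phi>1 \<phi>2 has_real_derivative \<tau> * D / (C - A)) (at d)"
proof -
  define c s where "c = cosh (d / 4)" and "s = sinh (d / 4)"
  have A: "A < 1" and AD: "D\<^sup>2 = (1 - A) * (1 + A)"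
    using gd_cos_less_1[OF \<phi>] gd_pythagoras[of \<phi>1 \<phi>2]
    by (auto simp: A_def D_def power2_eq_square algebra_simps)
  have c: "c > 0" "c\<^sup>2 = s\<^sup>2 + 1"
    by (simp_all add: c_def s_def cosh_square_eq)
  have CS: "C = c\<^sup>2 + s\<^sup>2" "S = 2 * s * c"
    unfolding C_def S_def c_def s_def by (fact cosh_sinh_half)+
  have pos: "C - A > 0"
    using gd_cos_less_cosh[OF \<phi>] unfolding C_def A_def by simp
  define \<kappa> where "\<kappa> = \<tau> * D / (1 - A)"
  define x where "x = \<kappa> * tanh (d / 4)"
  have x: "superposition \<tau> \<phi>1 \<phi>2 d / 2 = 2 * arctan x"
    by (simp add: superposition_def x_def \<kappa>_def A_def D_def)
  have nz: "(1 - A) * c\<^sup>2 \<noteq> 0" "1 - A \<noteq> 0" "c \<noteq> 0"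
    using A c(1) by auto
  have x': "x = \<tau> * D * s / ((1 - A) * c)"
    by (simp add: x_def \<kappa>_def c_def s_def tanh_def)
  have "x\<^sup>2 = ((1 - A) * ((1 + A) * s\<^sup>2)) / ((1 - A) * ((1 - A) * c\<^sup>2))"
    unfolding x' power_divide power_mult_distrib \<tau> AD by (simp add: power2_eq_square mult.assoc)
  then have x2: "x\<^sup>2 = (1 + A) * s\<^sup>2 / ((1 - A) * c\<^sup>2)"
    unfolding mult_divide_mult_cancel_left[OF nz(2)] .
  have "(1 - A) * c\<^sup>2 + (1 + A) * s\<^sup>2 = C - A" "(1 - A) * c\<^sup>2 - (1 + A) * s\<^sup>2 = 1 - A * C"
    unfolding CS c(2) by (simp_all add: algebra_simps)
  then have p: "1 + x\<^sup>2 = (C - A) / ((1 - A) * c\<^sup>2)" and m: "1 - x\<^sup>2 = (1 - A * C) / ((1 - A) * c\<^sup>2)"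
    using nz(1) unfolding x2 by (metis add_divide_distrib divide_self, metis diff_divide_distrib divide_self)
  show "cos (superposition \<tau> \<phi>1 \<phi>2 d / 2) = (1 - A * C) / (C - A)"
    unfolding x sin_cos_double_arctan p m using nz(1) by simp
  have quotient: "2 * (y / (u * v)) / (w / (u * v\<^sup>2)) = y * (2 * v) / w"
    if "u \<noteq> 0" "v \<noteq> 0" "w \<noteq> 0" for u v w y :: real
    using that by (simp add: field_simps power2_eq_square)
  show "sin (superposition \<tau> \<phi>1 \<phi>2 d / 2) = \<tau> * D * S / (C - A)"
    unfolding x sin_cos_double_arctan p unfolding x' CS(2) using quotient[OF nz(2,3), of "C - A" "\<tau> * D * s"] pos
    by (simp add: mult_ac)
  have "1 - (tanh (d / 4))\<^sup>2 = 1 / c\<^sup>2"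
  proof -
    have "1 - s\<^sup>2 / c\<^sup>2 = (c\<^sup>2 - s\<^sup>2) / c\<^sup>2"
      using nz(3) by (simp add: diff_divide_distrib)
    then show ?thesis
      using c(2) by (simp add: tanh_def power_divide flip: c_def s_def)
  qed
  then have "\<kappa> * (1 - (tanh (d / 4))\<^sup>2) * inverse (1 + x\<^sup>2) = \<tau> * D / (C - A)"
    unfolding p \<kappa>_def using nz pos by simp
  moreover have "(superposition \<tau> \<phi>1 \<phi>2 has_real_derivative
      \<kappa> * (1 - (tanh (d / 4))\<^sup>2) * inverse (1 + x\<^sup>2)) (at d)"
    unfolding superposition_def[abs_def] A_def[symmetric] D_def[symmetric] \<kappa>_def[symmetric] x_def
    by (rule derivative_eq_intros refl | simp)+
  ultimately show "(superposition \<tau> \<phi>1 \<phi>2 has_real_derivative \<tau> * D / (C - A)) (at d)"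
    by simp
qed

text \<open>The algebra behind the transformation of \<open>\<alpha>'\<close> into \<open>\<alpha>s\<close>. The variables stand for
  \<open>r\<^sub>i = 1 / cosh \<phi>\<^sub>i\<close>, \<open>t\<^sub>i = tanh \<phi>\<^sub>i\<close>, \<open>h, k = sinh, cosh (\<alpha>' / 2)\<close>, \<open>h'', k'' = sinh, cosh (\<alpha>'' / 2)\<close>,
  \<open>C, S = cosh, sinh ((\<alpha>'' - \<alpha>') / 2)\<close>, \<open>sa, ca = sin, cos (\<alpha> / 2)\<close> and \<open>sb, cb = sin, cos (\<alpha>s / 2)\<close>. Once
  \<open>h''\<close> and \<open>k''\<close> are expressed by \<open>h\<close> and \<open>k\<close>, both sides are linear in each of the pairs \<open>(h, k)\<close> and
  \<open>(sa, ca)\<close>, and the coefficients agree by the rotation formulas.\<close>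

lemma Baecklund0_identity:
  fixes A D C S \<tau> r1 t1 r2 t2 h k h'' k'' sa ca :: real
  assumes "\<tau>\<^sup>2 = 1"
    and "r1 = A * r2 - D * t2" "t1 = A * t2 + D * r2" "r2 = A * r1 + D * t1" "t2 = A * t1 - D * r1"
    and "h'' = S * k + C * h" "k'' = C * k + S * h"
    and "C - A \<noteq> 0"
  defines "sb \<equiv> (\<tau> * D * S * ca - (1 - A * C) * sa) / (C - A)"
    and "cb \<equiv> ((1 - A * C) * ca + \<tau> * D * S * sa) / (C - A)"
  shows "\<tau> * D / (C - A) * ((r2 * h'' * ca + \<tau> * t2 * k'' * sa) - (r1 * h * ca + \<tau> * t1 * k * sa))
      + (r1 * k * sa - \<tau> * t1 * h * ca) = r2 * sb * k + \<tau> * t2 * cb * h"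
    and "\<tau> * D / (C - A) * ((- r2 * k'' * sa + \<tau> * t2 * h'' * ca) - (- r1 * k * sa + \<tau> * t1 * h * ca))
      + (r1 * h * ca + \<tau> * t1 * k * sa) = - r2 * cb * h + \<tau> * t2 * sb * k"
proof -
  have "\<tau> * D * ((r2 * h'' * ca + \<tau> * t2 * k'' * sa) - (r1 * h * ca + \<tau> * t1 * k * sa))
      + (r1 * k * sa - \<tau> * t1 * h * ca) * (C - A) =
      r2 * (\<tau> * D * S * ca - (1 - A * C) * sa) * k + \<tau> * t2 * ((1 - A * C) * ca + \<tau> * D * S * sa) * h"
    using assms(1-7) by algebra
  then show "\<tau> * D / (C - A) * ((r2 * h'' * ca + \<tau> * t2 * k'' * sa) - (r1 * h * ca + \<tau> * t1 * k * sa))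
      + (r1 * k * sa - \<tau> * t1 * h * ca) = r2 * sb * k + \<tau> * t2 * cb * h"
    using assms(8) unfolding sb_def cb_def by (simp add: divide_simps mult_ac)
  have "\<tau> * D * ((- r2 * k'' * sa + \<tau> * t2 * h'' * ca) - (- r1 * k * sa + \<tau> * t1 * h * ca))
      + (r1 * h * ca + \<tau> * t1 * k * sa) * (C - A) =
      - r2 * ((1 - A * C) * ca + \<tau> * D * S * sa) * h + \<tau> * t2 * (\<tau> * D * S * ca - (1 - A * C) * sa) * k"
    using assms(1-7) by algebra
  then show "\<tau> * D / (C - A) * ((- r2 * k'' * sa + \<tau> * t2 * h'' * ca) - (- r1 * k * sa + \<tau> * t1 * h * ca))
      + (r1 * h * ca + \<tau> * t1 * k * sa) = - r2 * cb * h + \<tau> * t2 * sb * k"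
    using assms(8) unfolding sb_def cb_def by (simp add: divide_simps mult_ac)
qed

text \<open>In the same notation, \<open>d1\<close> and \<open>d2\<close> are the partial derivatives of \<open>\<alpha>'' - \<alpha>'\<close>, and the left-hand
  side is the Laplacian of \<open>\<alpha>s\<close>. Its first two terms cancel to a large extent: \<open>d1\<^sup>2 + d2\<^sup>2\<close>
  contains \<open>4 (C - A) (k k'' + h h'')\<close>, and \<open>h'' k'' - h k = S (k k'' + h h'')\<close>, so that
  \<open>k k'' + h h'' = cosh ((\<alpha>' + \<alpha>'') / 2)\<close> disappears from the sum.\<close>

lemma sine_Gordon_identity:
  fixes A D C S \<tau> r1 t1 r2 t2 h k h'' k'' sa ca :: real
  assumes "\<tau>\<^sup>2 = 1" "A\<^sup>2 + D\<^sup>2 = 1"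
    and "r2\<^sup>2 + t2\<^sup>2 = 1" "r1 = A * r2 - D * t2" "t1 = A * t2 + D * r2"
    and "k\<^sup>2 = h\<^sup>2 + 1" "C\<^sup>2 = S\<^sup>2 + 1" "h'' = S * k + C * h" "k'' = C * k + S * h"
    and "sa\<^sup>2 + ca\<^sup>2 = 1"
    and "C - A \<noteq> 0"
  defines "d1 \<equiv> 2 * ((r2 * h'' * ca + \<tau> * t2 * k'' * sa) - (r1 * h * ca + \<tau> * t1 * k * sa))"
    and "d2 \<equiv> 2 * ((- r2 * k'' * sa + \<tau> * t2 * h'' * ca) - (- r1 * k * sa + \<tau> * t1 * h * ca))"
    and "sb \<equiv> (\<tau> * D * S * ca - (1 - A * C) * sa) / (C - A)"
    and "cb \<equiv> ((1 - A * C) * ca + \<tau> * D * S * sa) / (C - A)"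
  shows "- (\<tau> * D * S / 2) / (C - A)\<^sup>2 * (d1\<^sup>2 + d2\<^sup>2)
    + \<tau> * D / (C - A) * (2 * h'' * k'' - 2 * h * k) - 2 * sa * ca = 2 * sb * cb"
proof -
  have R: "(C - A)\<^sup>2 = (1 - A * C)\<^sup>2 + (D * S)\<^sup>2"
    using assms(2,7) by algebra
  have SM: "h'' * k'' - h * k = S * (k * k'' + h * h'')"
    using assms(6-9) by algebra
  have r1t1: "r1\<^sup>2 + t1\<^sup>2 = 1" "r1 * r2 + t1 * t2 = A" "t1 * r2 - r1 * t2 = D" "h'' * k - k'' * h = S"
    using assms(2-9) by algebra+
  have N: "d1\<^sup>2 + d2\<^sup>2 = 4 * (ca\<^sup>2 * (h''\<^sup>2 + h\<^sup>2 - 2 * A * h * h'') + sa\<^sup>2 * (k''\<^sup>2 + k\<^sup>2 - 2 * A * k * k'')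
      - 2 * \<tau> * sa * ca * D * S)"
    using assms(1,3) r1t1 unfolding d1_def d2_def by algebra
  have "ca\<^sup>2 * (h''\<^sup>2 + h\<^sup>2 - 2 * A * h * h'') + sa\<^sup>2 * (k''\<^sup>2 + k\<^sup>2 - 2 * A * k * k'')
      = (C - A) * (k * k'' + h * h'') - (1 - A * C) * (ca\<^sup>2 - sa\<^sup>2)"
    using assms(6-10) by algebra
  then have N: "d1\<^sup>2 + d2\<^sup>2 = 4 * ((C - A) * (k * k'' + h * h'') - (1 - A * C) * (ca\<^sup>2 - sa\<^sup>2)
      - 2 * \<tau> * sa * ca * D * S)"
    unfolding N by (simp only:)
  have "- (\<tau> * D * S / 2) * (d1\<^sup>2 + d2\<^sup>2) + \<tau> * D * (C - A) * (2 * h'' * k'' - 2 * h * k)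
      - 2 * sa * ca * (C - A)\<^sup>2 =
      2 * (\<tau> * D * S * ca - (1 - A * C) * sa) * ((1 - A * C) * ca + \<tau> * D * S * sa)"
    using assms(1) N R SM by algebra
  moreover have "- (\<tau> * D * S / 2) / e\<^sup>2 * n + \<tau> * D / e * m - 2 * sa * ca =
      (- (\<tau> * D * S / 2) * n + \<tau> * D * e * m - 2 * sa * ca * e\<^sup>2) / e\<^sup>2" if "e \<noteq> 0" for e n m :: real
    using that by (simp add: field_simps power2_eq_square)
  ultimately show ?thesis
    using assms(11) unfolding sb_def cb_def by (simp add: power2_eq_square)
qed

text \<open>With \<open>z = (\<alpha> + \<beta>) / 4\<close>, \<open>y = (\<alpha> - \<beta>) / 4\<close>, \<open>\<mu> = (\<alpha>' + \<alpha>'') / 4\<close> and \<open>\<nu> = (\<alpha>'' - \<alpha>') / 4\<close>, the left-hand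
  sides are half the differences of the two expressions for each partial derivative of a common
  transform \<open>\<beta>\<close>. Expanding by the addition theorems leaves four brackets in \<open>z\<close> and \<open>\<nu>\<close>, and each of them is a
  multiple of \<open>G\<close>, since \<open>\<kappa> = \<tau> D / (1 - A)\<close> satisfies \<open>\<tau> (t1 + t2) = \<kappa> (r2 - r1)\<close> and
  \<open>r1 + r2 = \<kappa> \<tau> (t1 - t2)\<close>.\<close>

lemma Baecklund_consistency_factor:
  fixes A D \<tau> r1 t1 r2 t2 \<mu> \<nu> y z :: real
  assumes "\<tau>\<^sup>2 = 1" and A: "A \<noteq> 1"
    and "r1 = A * r2 - D * t2" "t1 = A * t2 + D * r2" "r2 = A * r1 + D * t1" "t2 = A * t1 - D * r1"
  defines "G \<equiv> sin z * cosh \<nu> - \<tau> * D / (1 - A) * cos z * sinh \<nu>"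
  shows "(r2 * sin (z - y) * cosh (\<mu> - \<nu>) + \<tau> * t2 * cos (z - y) * sinh (\<mu> - \<nu>)
        - r1 * cosh (\<mu> - \<nu>) * sin (z + y) + \<tau> * t1 * sinh (\<mu> - \<nu>) * cos (z + y))
      - (r1 * sin (z - y) * cosh (\<mu> + \<nu>) + \<tau> * t1 * cos (z - y) * sinh (\<mu> + \<nu>)
        - r2 * cosh (\<mu> + \<nu>) * sin (z + y) + \<tau> * t2 * sinh (\<mu> + \<nu>) * cos (z + y)) =
      2 * G * ((r2 - r1) * (cosh \<mu> * cos y) - \<tau> * (t1 - t2) * (sinh \<mu> * sin y))"
    and "(- r2 * cos (z - y) * sinh (\<mu> - \<nu>) + \<tau> * t2 * sin (z - y) * cosh (\<mu> - \<nu>)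
        - r1 * sinh (\<mu> - \<nu>) * cos (z + y) - \<tau> * t1 * cosh (\<mu> - \<nu>) * sin (z + y))
      - (- r1 * cos (z - y) * sinh (\<mu> + \<nu>) + \<tau> * t1 * sin (z - y) * cosh (\<mu> + \<nu>)
        - r2 * sinh (\<mu> + \<nu>) * cos (z + y) - \<tau> * t2 * cosh (\<mu> + \<nu>) * sin (z + y)) =
      - 2 * G * (\<tau> * (t1 - t2) * (cosh \<mu> * cos y) + (r2 - r1) * (sinh \<mu> * sin y))"
proof -
  define \<kappa> where "\<kappa> = \<tau> * D / (1 - A)"
  have k: "\<kappa> * (1 - A) = \<tau> * D"
    using A by (simp add: \<kappa>_def)
  have "(1 - A) * (\<tau> * (t1 + t2)) = (1 - A) * (\<kappa> * (r2 - r1))"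
    "(1 - A) * (r1 + r2) = (1 - A) * (\<kappa> * \<tau> * (t1 - t2))"
    using k assms(1,3-6) by algebra+
  then have \<kappa>: "\<tau> * (t1 + t2) = \<kappa> * (r2 - r1)" "r1 + r2 = \<kappa> * \<tau> * (t1 - t2)"
    using A by simp_all
  note expand = G_def \<kappa>_def[symmetric] sin_add cos_add sin_diff cos_diff sinh_add cosh_add sinh_diff cosh_diff
  show "(r2 * sin (z - y) * cosh (\<mu> - \<nu>) + \<tau> * t2 * cos (z - y) * sinh (\<mu> - \<nu>)
        - r1 * cosh (\<mu> - \<nu>) * sin (z + y) + \<tau> * t1 * sinh (\<mu> - \<nu>) * cos (z + y))
      - (r1 * sin (z - y) * cosh (\<mu> + \<nu>) + \<tau> * t1 * cos (z - y) * sinh (\<mu> + \<nu>)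
        - r2 * cosh (\<mu> + \<nu>) * sin (z + y) + \<tau> * t2 * sinh (\<mu> + \<nu>) * cos (z + y)) =
      2 * G * ((r2 - r1) * (cosh \<mu> * cos y) - \<tau> * (t1 - t2) * (sinh \<mu> * sin y))"
    unfolding expand using \<kappa> assms(1) by algebra
  show "(- r2 * cos (z - y) * sinh (\<mu> - \<nu>) + \<tau> * t2 * sin (z - y) * cosh (\<mu> - \<nu>)
        - r1 * sinh (\<mu> - \<nu>) * cos (z + y) - \<tau> * t1 * cosh (\<mu> - \<nu>) * sin (z + y))
      - (- r1 * cos (z - y) * sinh (\<mu> + \<nu>) + \<tau> * t1 * sin (z - y) * cosh (\<mu> + \<nu>)
        - r2 * sinh (\<mu> + \<nu>) * cos (z + y) - \<tau> * t2 * cosh (\<mu> + \<nu>) * sin (z + y)) =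
      - 2 * G * (\<tau> * (t1 - t2) * (cosh \<mu> * cos y) + (r2 - r1) * (sinh \<mu> * sin y))"
    unfolding expand using \<kappa> assms(1) by algebra
qed

text \<open>The tangent formula says that \<open>(cos (s / 2), sin (s / 2))\<close> is parallel to \<open>(Q, P)\<close> rotated by \<open>- a / 2\<close>.
  The infinite values of the tangents correspond to vanishing cosines.\<close>

lemma tan_half_superpositionI:
  assumes K: "K \<noteq> 0"
    and s: "K * sin (s / 2) = P * cos (a / 2) - Q * sin (a / 2)"
    and c: "K * cos (s / 2) = Q * cos (a / 2) + P * sin (a / 2)"
  shows "tan_half_superposition P Q a s"
proof (cases "cos (a / 2) = 0")
  case False
  have "Q + P * tan (a / 2) = K * cos (s / 2) / cos (a / 2)"
    "P - Q * tan (a / 2) = K * sin (s / 2) / cos (a / 2)"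
    unfolding s c using False by (simp_all add: tan_def field_simps)
  then show ?thesis
    using K False by (simp add: tan_half_superposition_def tan_def)
next
  case True
  then have "sin (a / 2) \<noteq> 0"
    using sin_cos_squared_add[of "a / 2"] by auto
  moreover have "cos (s / 2) = P * sin (a / 2) / K" "sin (s / 2) = - Q * sin (a / 2) / K"
    using s c True K by (simp_all add: field_simps)
  ultimately show ?thesis
    using K True by (simp add: tan_half_superposition_def tan_def)
qed

section \<open>Existence and uniqueness of the fourth solution\<close>

lemma Baecklund1_gradient:
  assumes "Baecklund1 \<tau> \<phi> U \<beta> \<beta>'" "x \<in> U"
  defines "r \<equiv> 1 / cosh \<phi>" and "t \<equiv> tanh \<phi>"
  shows "pd1 \<beta>' x = pd2 \<beta> x + 2 * (r * sinh (\<beta>' x / 2) * cos (\<beta> x / 2) + \<tau> * t * cosh (\<beta>' x / 2) * sin (\<beta> x / 2))"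
    and "pd2 \<beta>' x = - pd1 \<beta> x + 2 * (- r * cosh (\<beta>' x / 2) * sin (\<beta> x / 2) + \<tau> * t * sinh (\<beta>' x / 2) * cos (\<beta> x / 2))"
  using assms(1,2) by (auto simp: Baecklund1_def r_def t_def tanh_def algebra_simps)

lemma Baecklund0_iff_gradient:
  fixes \<phi> :: real
  defines "r \<equiv> 1 / cosh \<phi>" and "t \<equiv> tanh \<phi>"
  shows "Baecklund0 \<tau> \<phi> U \<beta> \<beta>' \<longleftrightarrow> (\<forall>x\<in>U.
    pd1 \<beta>' x = pd2 \<beta> x + 2 * (r * sin (\<beta>' x / 2) * cosh (\<beta> x / 2) + \<tau> * t * cos (\<beta>' x / 2) * sinh (\<beta> x / 2)) \<and>
    pd2 \<beta>' x = - pd1 \<beta> x + 2 * (- r * cos (\<beta>' x / 2) * sinh (\<beta> x / 2) + \<tau> * t * sin (\<beta>' x / 2) * cosh (\<beta> x / 2)))"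
proof -
  have "p = q + 2 * (r * X * Y + \<tau> * t * Z * W) \<longleftrightarrow>
      p - q = 2 / cosh \<phi> * X * Y + 2 * \<tau> * sinh \<phi> / cosh \<phi> * Z * W"
    "p = - q + 2 * (- r * X * Y + \<tau> * t * Z * W) \<longleftrightarrow>
      p + q = - (2 / cosh \<phi>) * X * Y + 2 * \<tau> * sinh \<phi> / cosh \<phi> * Z * W"
    for p q X Y Z W :: real
    by (auto simp: r_def t_def tanh_def algebra_simps)
  then show ?thesis
    by (simp only: Baecklund0_def)
qed

lemma superposition_sin_cos:
  fixes d a :: real
  assumes "\<tau>\<^sup>2 = 1" and "\<phi>1 \<noteq> \<phi>2"
  defines "A \<equiv> gd_cos \<phi>1 \<phi>2" and "D \<equiv> gd_sin \<phi>1 \<phi>2"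
    and "C \<equiv> cosh (d / 2)" and "S \<equiv> sinh (d / 2)"
  shows "sin ((superposition \<tau> \<phi>1 \<phi>2 d - a) / 2) = (\<tau> * D * S * cos (a / 2) - (1 - A * C) * sin (a / 2)) / (C - A)"
    and "cos ((superposition \<tau> \<phi>1 \<phi>2 d - a) / 2) = ((1 - A * C) * cos (a / 2) + \<tau> * D * S * sin (a / 2)) / (C - A)"
  unfolding diff_divide_distrib[of _ _ 2] sin_diff cos_diff superposition_half[OF assms(1,2)] A_def D_def C_def S_def
  by (simp_all add: add_divide_distrib diff_divide_distrib left_diff_distrib)

lemma pd_superposition:
  assumes \<tau>: "\<tau>\<^sup>2 = 1" and \<phi>: "\<phi>1 \<noteq> \<phi>2"
    and C1: "C1_on U \<alpha>" "C1_on U \<alpha>'" "C1_on U \<alpha>''" and x: "x \<in> U"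
  defines "w \<equiv> \<tau> * gd_sin \<phi>1 \<phi>2 / (cosh ((\<alpha>'' x - \<alpha>' x) / 2) - gd_cos \<phi>1 \<phi>2)"
  shows "pd1 (\<lambda>x. superposition \<tau> \<phi>1 \<phi>2 (\<alpha>'' x - \<alpha>' x) - \<alpha> x) x = w * (pd1 \<alpha>'' x - pd1 \<alpha>' x) - pd1 \<alpha> x"
    and "pd2 (\<lambda>x. superposition \<tau> \<phi>1 \<phi>2 (\<alpha>'' x - \<alpha>' x) - \<alpha> x) x = w * (pd2 \<alpha>'' x - pd2 \<alpha>' x) - pd2 \<alpha> x"
proof -
  note d = C1_on_diff[OF C1(3,2)]
  show "pd1 (\<lambda>x. superposition \<tau> \<phi>1 \<phi>2 (\<alpha>'' x - \<alpha>' x) - \<alpha> x) x = w * (pd1 \<alpha>'' x - pd1 \<alpha>' x) - pd1 \<alpha> x"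
    unfolding w_def pd1_diff[OF C1(3,2) x, symmetric]
    by (rule pd1_eqI, rule DERIV_diff[OF pd1_compose[OF d x] C1_on_pd1[OF C1(1) x]])
       (rule superposition_half(3)[OF \<tau> \<phi>])
  show "pd2 (\<lambda>x. superposition \<tau> \<phi>1 \<phi>2 (\<alpha>'' x - \<alpha>' x) - \<alpha> x) x = w * (pd2 \<alpha>'' x - pd2 \<alpha>' x) - pd2 \<alpha> x"
    unfolding w_def pd2_diff[OF C1(3,2) x, symmetric]
    by (rule pd2_eqI, rule DERIV_diff[OF pd2_compose[OF d x] C1_on_pd2[OF C1(1) x]])
       (rule superposition_half(3)[OF \<tau> \<phi>])
qed

lemma sinh_cosh_shift:
  fixes p q :: real
  shows "sinh q = sinh (q - p) * cosh p + cosh (q - p) * sinh p"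
    and "cosh q = cosh (q - p) * cosh p + sinh (q - p) * sinh p"
  using sinh_add[of "q - p" p] cosh_add[of "q - p" p] by simp_all

lemma superposition_Baecklund0:
  assumes \<tau>: "\<tau>\<^sup>2 = 1" and \<phi>: "\<phi>1 \<noteq> \<phi>2"
    and C1: "C1_on U \<alpha>" "C1_on U \<alpha>'" "C1_on U \<alpha>''"
    and B: "Baecklund1 \<tau> \<phi>1 U \<alpha> \<alpha>'" "Baecklund1 \<tau> \<phi>2 U \<alpha> \<alpha>''"
  shows "Baecklund0 \<tau> \<phi>2 U \<alpha>' (\<lambda>x. superposition \<tau> \<phi>1 \<phi>2 (\<alpha>'' x - \<alpha>' x) - \<alpha> x)"
  unfolding Baecklund0_iff_gradient
proof
  let ?u = "\<lambda>x. superposition \<tau> \<phi>1 \<phi>2 (\<alpha>'' x - \<alpha>' x) - \<alpha> x"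
  fix x assume x: "x \<in> U"
  let ?A = "gd_cos \<phi>1 \<phi>2" and ?C = "cosh (\<alpha>'' x / 2 - \<alpha>' x / 2)"
  have nz: "?C - ?A \<noteq> 0"
    using gd_cos_less_cosh[OF \<phi>, of "\<alpha>'' x / 2 - \<alpha>' x / 2"] by simp
  note id = Baecklund0_identity[OF \<tau> gd_rotate gd_rotate_back sinh_cosh_shift nz]
  note sc = superposition_sin_cos[OF \<tau> \<phi>, of "\<alpha>'' x - \<alpha>' x" "\<alpha> x", unfolded diff_divide_distrib[of "\<alpha>'' x"]]
  note g' = Baecklund1_gradient[OF B(1) x] and g'' = Baecklund1_gradient[OF B(2) x]
  note pd = pd_superposition[OF \<tau> \<phi> C1 x, unfolded diff_divide_distrib[of "\<alpha>'' x"]]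
  (* Here p + 2 y and p + 2 z are the derivatives of \<alpha>'' and \<alpha>' given by the first transformations,
     so that p, a derivative of \<alpha>, cancels; q is the other derivative of \<alpha>. *)
  have shift1: "w * (p + 2 * y - (p + 2 * z)) - q = - q + 2 * g + 2 * e"
    if "w * (y - z) + f = e" "f = - g" for w p q y z e f g :: real
    using that by (simp add: algebra_simps)
  have shift2: "w * (p + 2 * y - (p + 2 * z)) - q = - (q + 2 * f) + 2 * e"
    if "w * (y - z) + f = e" for w p q y z e f :: real
    using that by (simp add: algebra_simps)
  show "pd1 ?u x = pd2 \<alpha>' x + 2 * (1 / cosh \<phi>2 * sin (?u x / 2) * cosh (\<alpha>' x / 2)
      + \<tau> * tanh \<phi>2 * cos (?u x / 2) * sinh (\<alpha>' x / 2)) \<and>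
    pd2 ?u x = - pd1 \<alpha>' x + 2 * (- (1 / cosh \<phi>2) * cos (?u x / 2) * sinh (\<alpha>' x / 2)
      + \<tau> * tanh \<phi>2 * sin (?u x / 2) * cosh (\<alpha>' x / 2))"
    unfolding pd sc g' g''
    by (intro conjI shift1[OF id(1)] shift2[OF id(2)]) simp
qed

text \<open>The Laplacian of \<open>\<alpha>s\<close> is expressed by the gradient of \<open>\<alpha>'' - \<alpha>'\<close>, known from the two transformations, and by the
  Laplacians of \<open>\<alpha>\<close>, \<open>\<alpha>'\<close> and \<open>\<alpha>''\<close>, known from their equations.\<close>

lemma superposition_sine_Gordon:
  assumes \<tau>: "\<tau>\<^sup>2 = 1" and \<phi>: "\<phi>1 \<noteq> \<phi>2" and U: "open U"
    and sG: "elliptic_sine_Gordon U \<alpha>"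
    and shG: "elliptic_sinh_Gordon U \<alpha>'" "elliptic_sinh_Gordon U \<alpha>''"
    and B: "Baecklund1 \<tau> \<phi>1 U \<alpha> \<alpha>'" "Baecklund1 \<tau> \<phi>2 U \<alpha> \<alpha>''"
  shows "elliptic_sine_Gordon U (\<lambda>x. superposition \<tau> \<phi>1 \<phi>2 (\<alpha>'' x - \<alpha>' x) - \<alpha> x)"
proof -
  let ?A = "gd_cos \<phi>1 \<phi>2" and ?D = "gd_sin \<phi>1 \<phi>2"
  have C2: "C2_on U \<alpha>" "C2_on U \<alpha>'" "C2_on U \<alpha>''"
    using sG shG by (auto simp: elliptic_sine_Gordon_def elliptic_sinh_Gordon_def)
  have C1: "C1_on U \<alpha>" "C1_on U \<alpha>'" "C1_on U \<alpha>''"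
    using C2 by (auto simp: C2_on_def)
  let ?d = "\<lambda>x. \<alpha>'' x - \<alpha>' x" and ?f = "superposition \<tau> \<phi>1 \<phi>2"
  let ?f' = "\<lambda>s. \<tau> * ?D / (cosh (s / 2) - ?A)"
  let ?f'' = "\<lambda>s. - (\<tau> * ?D * sinh (s / 2) / 2) / (cosh (s / 2) - ?A)\<^sup>2"
  have nz: "cosh s - ?A \<noteq> 0" for s :: real
    using gd_cos_less_cosh[OF \<phi>, of s] by simp
  have f': "(?f' has_real_derivative ?f'' s) (at s)" for s
    using nz[of "s / 2"] by (auto intro!: derivative_eq_intros simp: power2_eq_square)
  have f'': "continuous_on UNIV ?f''"
    using nz by (intro continuous_intros) auto
  note d = C2_on_diff[OF U C2(3,2)]
  have fd: "C2_on U (\<lambda>x. ?f (?d x))"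
    by (rule C2_on_compose(1)[OF U d(1) _ _ f'']) (rule superposition_half(3)[OF \<tau> \<phi>], rule f')
  have lap_fd: "pd1 (pd1 (\<lambda>x. ?f (?d x))) x + pd2 (pd2 (\<lambda>x. ?f (?d x))) x =
      ?f'' (?d x) * ((pd1 ?d x)\<^sup>2 + (pd2 ?d x)\<^sup>2) + ?f' (?d x) * (pd1 (pd1 ?d) x + pd2 (pd2 ?d) x)"
    if "x \<in> U" for x
    by (rule C2_on_compose(2)[OF U d(1) _ _ f'' that]) (rule superposition_half(3)[OF \<tau> \<phi>], rule f')
  have "pd1 (pd1 (\<lambda>x. ?f (?d x) - \<alpha> x)) x + pd2 (pd2 (\<lambda>x. ?f (?d x) - \<alpha> x)) x = sin (?f (?d x) - \<alpha> x)"
    if x: "x \<in> U" for x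
  proof -
    let ?a' = "\<alpha>' x / 2" and ?a'' = "\<alpha>'' x / 2" and ?a = "\<alpha> x / 2"
    let ?r1 = "1 / cosh \<phi>1" and ?r2 = "1 / cosh \<phi>2"
    have r2: "?r2\<^sup>2 + (tanh \<phi>2)\<^sup>2 = 1"
      by (simp add: tanh_def power_divide cosh_square_eq add_nonneg_eq_0_iff flip: add_divide_distrib)
    note identity = sine_Gordon_identity[OF \<tau> gd_pythagoras r2 gd_rotate cosh_square_eq[of ?a'] cosh_square_eq
        sinh_cosh_shift[of ?a'' ?a'] sin_cos_squared_add[of ?a] nz]
    have grad: "pd1 ?d x = 2 * ((?r2 * sinh ?a'' * cos ?a + \<tau> * tanh \<phi>2 * cosh ?a'' * sin ?a)
        - (?r1 * sinh ?a' * cos ?a + \<tau> * tanh \<phi>1 * cosh ?a' * sin ?a))"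
      "pd2 ?d x = 2 * ((- ?r2 * cosh ?a'' * sin ?a + \<tau> * tanh \<phi>2 * sinh ?a'' * cos ?a)
        - (- ?r1 * cosh ?a' * sin ?a + \<tau> * tanh \<phi>1 * sinh ?a' * cos ?a))"
      unfolding pd1_diff[OF C1(3,2) x] pd2_diff[OF C1(3,2) x]
        Baecklund1_gradient[OF B(1) x] Baecklund1_gradient[OF B(2) x] by (simp_all only: algebra_simps)
    have lap: "pd1 (pd1 ?d) x + pd2 (pd2 ?d) x = 2 * sinh ?a'' * cosh ?a'' - 2 * sinh ?a' * cosh ?a'"
      using d(2)[OF x] shG x sinh_double[of ?a'] sinh_double[of ?a'']
      by (simp add: elliptic_sinh_Gordon_def)
    have sin_half: "sin s = 2 * sin (s / 2) * cos (s / 2)" for s :: real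
      using sin_double[of "s / 2"] by simp
    have sG_x: "pd1 (pd1 \<alpha>) x + pd2 (pd2 \<alpha>) x = sin (\<alpha> x)"
      using sG x by (simp add: elliptic_sine_Gordon_def)
    show ?thesis
      unfolding C2_on_diff(2)[OF U fd C2(1) x] lap_fd[OF x] lap grad sG_x
        sin_half[of "\<alpha> x"] sin_half[of "?f (?d x) - \<alpha> x"]
        superposition_sin_cos[OF \<tau> \<phi>] diff_divide_distrib[of "\<alpha>'' x"]
      by (rule identity)
  qed
  then show ?thesis
    using C2_on_diff(1)[OF U fd C2(1)] by (simp add: elliptic_sine_Gordon_def)
qed

text \<open>If the common factor \<open>G\<close> vanishes, then \<open>tan z = \<kappa> tanh \<nu>\<close>, which is the first alternative. Otherwise
  both cofactors vanish. They are the images of \<open>cosh \<mu> cos y\<close> and \<open>sinh \<mu> sin y\<close> under a rotation followed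
  by a nonzero scaling, hence both of these products vanish, so that \<open>cos y = 0\<close> and \<open>\<mu> = 0\<close>.\<close>

lemma Baecklund0_pair_values:
  assumes \<tau>: "\<tau>\<^sup>2 = 1" and \<phi>: "\<phi>1 \<noteq> \<phi>2"
    and B1: "Baecklund1 \<tau> \<phi>1 U \<alpha> \<alpha>'" "Baecklund1 \<tau> \<phi>2 U \<alpha> \<alpha>''"
    and B0: "Baecklund0 \<tau> \<phi>2 U \<alpha>' \<beta>" "Baecklund0 \<tau> \<phi>1 U \<alpha>'' \<beta>" and x: "x \<in> U"
  shows "(\<exists>k::int. \<beta> x = superposition \<tau> \<phi>1 \<phi>2 (\<alpha>'' x - \<alpha>' x) - \<alpha> x + 4 * pi * of_int k) \<or>
    \<alpha>'' x = - \<alpha>' x \<and> (\<exists>k::int. \<beta> x = \<alpha> x + 2 * pi + 4 * pi * of_int k)"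
proof -
  define r1 t1 r2 t2 where "r1 = 1 / cosh \<phi>1" "t1 = tanh \<phi>1" "r2 = 1 / cosh \<phi>2" "t2 = tanh \<phi>2"
  note rt = this
  define A D where "A = gd_cos \<phi>1 \<phi>2" and "D = gd_sin \<phi>1 \<phi>2"
  have rotate: "r1 = A * r2 - D * t2" "t1 = A * t2 + D * r2" "r2 = A * r1 + D * t1" "t2 = A * t1 - D * r1"
    unfolding rt A_def D_def by (fact gd_rotate gd_rotate_back)+
  have A: "A < 1" "A \<noteq> 1"
    using gd_cos_less_1[OF \<phi>] by (auto simp: A_def)
  define z y where "z = (\<alpha> x + \<beta> x) / 4" and "y = (\<alpha> x - \<beta> x) / 4"
  define \<mu> \<nu> where "\<mu> = (\<alpha>' x + \<alpha>'' x) / 4" and "\<nu> = (\<alpha>'' x - \<alpha>' x) / 4"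
  have halves: "z + y = \<alpha> x / 2" "z - y = \<beta> x / 2" "\<mu> + \<nu> = \<alpha>'' x / 2" "\<mu> - \<nu> = \<alpha>' x / 2"
    by (simp_all add: z_def y_def \<mu>_def \<nu>_def field_simps)
  define \<kappa> where "\<kappa> = \<tau> * D / (1 - A)"
  define G where "G = sin z * cosh \<nu> - \<kappa> * cos z * sinh \<nu>"
  note factor = Baecklund_consistency_factor[OF \<tau> A(2) rotate, where z = z and y = y and \<mu> = \<mu> and \<nu> = \<nu>,
       folded \<kappa>_def, folded G_def, unfolded halves]
  note g = Baecklund1_gradient[OF B1(1) x, folded rt] Baecklund1_gradient[OF B1(2) x, folded rt]
    B0[unfolded Baecklund0_iff_gradient, THEN bspec, OF x, THEN conjunct1, folded rt]
    B0[unfolded Baecklund0_iff_gradient, THEN bspec, OF x, THEN conjunct2, folded rt]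
  define E F where "E = (r2 - r1) * (cosh \<mu> * cos y) - \<tau> * (t1 - t2) * (sinh \<mu> * sin y)"
    and "F = \<tau> * (t1 - t2) * (cosh \<mu> * cos y) + (r2 - r1) * (sinh \<mu> * sin y)"
  have "2 * G * E = 0"
    unfolding E_def factor[symmetric] using g by algebra
  moreover have "- 2 * G * F = 0"
    unfolding F_def factor[symmetric] using g by algebra
  ultimately consider "G = 0" | "E = 0" "F = 0" by auto
  then show ?thesis
  proof cases
    case 1
    define w where "w = arctan (\<kappa> * tanh \<nu>)"
    have "sin z = tan w * cos z"
      using 1 by (simp add: G_def w_def tan_arctan tanh_def field_simps)
    moreover have "cos w \<noteq> 0"
      by (simp add: w_def)
    ultimately have "sin (z - w) = 0"
      by (simp add: sin_diff tan_def)
    then obtain k :: int where "z - w = of_int k * pi"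
      by (auto simp: sin_zero_iff_int2)
    then have "\<beta> x = 4 * w - \<alpha> x + 4 * pi * of_int k"
      by (simp add: z_def field_simps)
    moreover have "superposition \<tau> \<phi>1 \<phi>2 (\<alpha>'' x - \<alpha>' x) = 4 * w"
      by (simp add: superposition_def w_def \<kappa>_def A_def D_def \<nu>_def)
    ultimately show ?thesis by auto
  next
    case 2
    (* Two equal pairs (r, t) would give r1 + r2 = A (r1 + r2), although A < 1. *)
    have norm: "(r2 - r1)\<^sup>2 + (\<tau> * (t1 - t2))\<^sup>2 > 0"
    proof -
      have "t1 + t2 = A * (t1 + t2) + D * (r2 - r1)" "r1 + r2 = A * (r1 + r2) + D * (t1 - t2)"
        using rotate by algebra+
      moreover have "r1 + r2 > 0"
        by (simp add: rt add_pos_pos)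
      ultimately have "r2 - r1 \<noteq> 0 \<or> t1 - t2 \<noteq> 0"
        using A by auto
      then show ?thesis
        using \<tau> by (auto simp: sum_power2_gt_zero_iff)
    qed
    have "((r2 - r1)\<^sup>2 + (\<tau> * (t1 - t2))\<^sup>2) * (cosh \<mu> * cos y) = 0"
      "((r2 - r1)\<^sup>2 + (\<tau> * (t1 - t2))\<^sup>2) * (sinh \<mu> * sin y) = 0"
      using 2 unfolding E_def F_def by algebra+
    then have "cos y = 0" "sinh \<mu> * sin y = 0"
      using norm by auto
    moreover from this have "sin y \<noteq> 0"
      using sin_cos_squared_add[of y] by auto
    ultimately have "cos y = 0" "\<mu> = 0" by auto
    then obtain k :: int where "y = of_int k * pi + pi / 2" and "\<alpha>'' x = - \<alpha>' x"
      by (auto simp: cos_zero_iff_int2 \<mu>_def)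
    moreover from this have "\<beta> x = \<alpha> x + 2 * pi + 4 * pi * of_int (- k - 1)"
      by (simp add: y_def field_simps)
    ultimately show ?thesis by blast
  qed
qed

lemma DERIV_add_const_iff:
  "((\<lambda>t. f t + c) has_real_derivative D) (at s) \<longleftrightarrow> (f has_real_derivative D) (at s)"
proof
  assume "((\<lambda>t. f t + c) has_real_derivative D) (at s)"
  from DERIV_diff[OF this DERIV_const[of c]] show "(f has_real_derivative D) (at s)" by simp
next
  assume "(f has_real_derivative D) (at s)"
  from DERIV_add[OF this DERIV_const[of c]] show "((\<lambda>t. f t + c) has_real_derivative D) (at s)" by simp
qed

lemma pd_add_const: "pd1 (\<lambda>x. u x + c) = pd1 u" "pd2 (\<lambda>x. u x + c) = pd2 u"
  by (simp_all add: pd1_def pd2_def deriv_def fun_eq_iff DERIV_add_const_iff)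

lemma C1_on_add_const: "C1_on U (\<lambda>x. u x + c) \<longleftrightarrow> C1_on U u"
  by (simp add: C1_on_def pd_add_const real_differentiable_def DERIV_add_const_iff)

lemma Baecklund0_add_period:
  "Baecklund0 \<tau> \<phi> U a (\<lambda>x. u x + 4 * pi * of_int k) \<longleftrightarrow> Baecklund0 \<tau> \<phi> U a u"
proof -
  have "(u x + 4 * pi * of_int k) / 2 = u x / 2 + 2 * pi * of_int k" for x
    by simp
  moreover have "sin (s + 2 * pi * of_int k) = sin s" "cos (s + 2 * pi * of_int k) = cos s" for s :: real
    using sin_cos_eq_iff[of "s + 2 * pi * of_int k" s] by auto
  ultimately show ?thesis
    by (simp only: Baecklund0_def pd_add_const)
qed

text \<open>With \<open>\<alpha>'' = - \<alpha>'\<close>, the equations of \<open>\<B>\<^sup>1\<close> solved for the gradient of \<open>\<alpha>\<close> are those of \<open>\<B>\<^sup>0\<close> with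
  \<open>- sin (\<alpha> / 2)\<close> and \<open>- cos (\<alpha> / 2)\<close> in place of \<open>sin (\<alpha> / 2)\<close> and \<open>cos (\<alpha> / 2)\<close>; the shift by
  \<open>2 \<pi>\<close> produces these signs.\<close>

lemma Baecklund0_add_2pi:
  assumes B: "Baecklund1 \<tau> \<phi> U \<alpha> \<alpha>''" and U: "open U" and \<alpha>': "C1_on U \<alpha>'"
    and opp: "\<And>x. x \<in> U \<Longrightarrow> \<alpha>'' x = - \<alpha>' x"
  shows "Baecklund0 \<tau> \<phi> U \<alpha>' (\<lambda>x. \<alpha> x + 2 * pi)"
  unfolding Baecklund0_iff_gradient pd_add_const
proof
  fix x assume x: "x \<in> U"
  have "pd1 \<alpha>'' x = pd1 (\<lambda>x. 0 - \<alpha>' x) x" "pd2 \<alpha>'' x = pd2 (\<lambda>x. 0 - \<alpha>' x) x"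
    using opp by (auto intro!: pd1_cong[OF U x] pd2_cong[OF U x])
  moreover have "pd1 (\<lambda>x. 0 - \<alpha>' x) x = - pd1 \<alpha>' x" "pd2 (\<lambda>x. 0 - \<alpha>' x) x = - pd2 \<alpha>' x"
    using pd1_eqI[OF DERIV_diff[OF DERIV_const[of 0] C1_on_pd1[OF \<alpha>' x]]]
      pd2_eqI[OF DERIV_diff[OF DERIV_const[of 0] C1_on_pd2[OF \<alpha>' x]]] by simp_all
  ultimately show "pd1 \<alpha> x = pd2 \<alpha>' x + 2 * (1 / cosh \<phi> * sin ((\<alpha> x + 2 * pi) / 2) * cosh (\<alpha>' x / 2)
      + \<tau> * tanh \<phi> * cos ((\<alpha> x + 2 * pi) / 2) * sinh (\<alpha>' x / 2)) \<and>
    pd2 \<alpha> x = - pd1 \<alpha>' x + 2 * (- (1 / cosh \<phi>) * cos ((\<alpha> x + 2 * pi) / 2) * sinh (\<alpha>' x / 2)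
      + \<tau> * tanh \<phi> * sin ((\<alpha> x + 2 * pi) / 2) * cosh (\<alpha>' x / 2))"
    using Baecklund1_gradient[OF B x] opp[OF x]
    by (simp add: add_divide_distrib algebra_simps flip: minus_divide_left)
qed

lemma superposition_tan_half:
  assumes \<tau>: "\<tau>\<^sup>2 = 1" and \<phi>: "\<phi>1 \<noteq> \<phi>2"
  shows "tan_half_superposition (P_tilde \<tau> \<phi>1 \<phi>2 a' a'') (Q_tilde \<phi>1 \<phi>2 a' a'') a
    (superposition \<tau> \<phi>1 \<phi>2 (a'' - a') - a)"
proof -
  let ?A = "gd_cos \<phi>1 \<phi>2" and ?D = "gd_sin \<phi>1 \<phi>2"
  let ?C = "cosh ((a'' - a') / 2)" and ?S = "sinh ((a'' - a') / 2)"
  define B where "B = cosh \<phi>1 * cosh \<phi>2"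
  have B: "B \<noteq> 0"
    by (simp add: B_def)
  have AD: "1 + sinh \<phi>1 * sinh \<phi>2 = B * ?A" "sinh \<phi>1 - sinh \<phi>2 = B * ?D"
    by (simp_all add: gd_cos_def gd_sin_def B_def)
  have nz: "?C - ?A \<noteq> 0"
    using gd_cos_less_cosh[OF \<phi>, of "(a'' - a') / 2"] by simp
  have P: "P_tilde \<tau> \<phi>1 \<phi>2 a' a'' = - B * (\<tau> * ?D * ?S)" and Q: "Q_tilde \<phi>1 \<phi>2 a' a'' = - B * (1 - ?A * ?C)"
    unfolding P_tilde_def Q_tilde_def AD B_def[symmetric] by (simp_all add: algebra_simps)
  show ?thesis
  proof (rule tan_half_superpositionI[where K = "- B * (?C - ?A)"])
    show "- B * (?C - ?A) \<noteq> 0"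
      using B nz by simp
    have cancel: "- B * (?C - ?A) * (X / (?C - ?A)) = - B * X" for X
      using nz by simp
    show "- B * (?C - ?A) * sin ((superposition \<tau> \<phi>1 \<phi>2 (a'' - a') - a) / 2) =
        P_tilde \<tau> \<phi>1 \<phi>2 a' a'' * cos (a / 2) - Q_tilde \<phi>1 \<phi>2 a' a'' * sin (a / 2)"
      "- B * (?C - ?A) * cos ((superposition \<tau> \<phi>1 \<phi>2 (a'' - a') - a) / 2) =
        Q_tilde \<phi>1 \<phi>2 a' a'' * cos (a / 2) + P_tilde \<tau> \<phi>1 \<phi>2 a' a'' * sin (a / 2)"
      unfolding superposition_sin_cos[OF \<tau> \<phi>] P Q cancel by (simp_all only: algebra_simps)
  qed
qed

theorem theorem3p3:
  fixes \<tau> \<phi>1 \<phi>2 :: real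
    and U :: "(real \<times> real) set"
    and \<alpha> \<alpha>' \<alpha>'' :: "real \<times> real \<Rightarrow> real"
  assumes "\<tau> \<in> {1, -1}"
    and "0 \<le> \<phi>1" and "0 \<le> \<phi>2" and "\<phi>1 \<noteq> \<phi>2"
    and "open U" and "connected U"
    and "elliptic_sine_Gordon U \<alpha>"
    and "elliptic_sinh_Gordon U \<alpha>'" and "elliptic_sinh_Gordon U \<alpha>''"
    and "Baecklund1 \<tau> \<phi>1 U \<alpha> \<alpha>'" and "Baecklund1 \<tau> \<phi>2 U \<alpha> \<alpha>''"
  shows "\<exists>\<alpha>s.
    (elliptic_sine_Gordon U \<alpha>s \<and> Baecklund0 \<tau> \<phi>2 U \<alpha>' \<alpha>s \<and> Baecklund0 \<tau> \<phi>1 U \<alpha>'' \<alpha>s) \<and>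
    (\<forall>\<beta>. elliptic_sine_Gordon U \<beta> \<and> Baecklund0 \<tau> \<phi>2 U \<alpha>' \<beta> \<and> Baecklund0 \<tau> \<phi>1 U \<alpha>'' \<beta> \<longrightarrow>
       (\<exists>k::int. \<forall>x\<in>U. \<beta> x = \<alpha>s x + 4 * pi * of_int k) \<or>
       ((\<forall>x\<in>U. \<alpha>'' x = - \<alpha>' x) \<and>
        (\<exists>k::int. \<forall>x\<in>U. \<beta> x = \<alpha> x + 2 * pi + 4 * pi * of_int k))) \<and>
    (\<forall>x\<in>U. tan_half_superposition
       (P_tilde \<tau> \<phi>1 \<phi>2 (\<alpha>' x) (\<alpha>'' x)) (Q_tilde \<phi>1 \<phi>2 (\<alpha>' x) (\<alpha>'' x)) (\<alpha> x) (\<alpha>s x))"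
proof -
  note \<phi> = \<open>\<phi>1 \<noteq> \<phi>2\<close> and U = \<open>open U\<close> \<open>connected U\<close>
    and B1 = \<open>Baecklund1 \<tau> \<phi>1 U \<alpha> \<alpha>'\<close> \<open>Baecklund1 \<tau> \<phi>2 U \<alpha> \<alpha>''\<close>
  have \<tau>: "\<tau>\<^sup>2 = 1"
    using assms(1) by auto
  have C1: "C1_on U \<alpha>" "C1_on U \<alpha>'" "C1_on U \<alpha>''"
    using assms(7-9) by (auto simp: elliptic_sine_Gordon_def elliptic_sinh_Gordon_def C2_on_def)
  let ?s = "\<lambda>x. superposition \<tau> \<phi>1 \<phi>2 (\<alpha>'' x - \<alpha>' x) - \<alpha> x"
  have sG: "elliptic_sine_Gordon U ?s"
    by (rule superposition_sine_Gordon[OF \<tau> \<phi> U(1) assms(7-9) B1])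
  then have C1s: "C1_on U ?s"
    by (simp add: elliptic_sine_Gordon_def C2_on_def)
  have B2: "Baecklund0 \<tau> \<phi>2 U \<alpha>' ?s"
    by (rule superposition_Baecklund0[OF \<tau> \<phi> C1 B1])
  (* Interchanging the roles of the two transforms negates the difference, which leaves
     the superposition unchanged. *)
  have "Baecklund0 \<tau> \<phi>1 U \<alpha>'' (\<lambda>x. superposition \<tau> \<phi>2 \<phi>1 (\<alpha>' x - \<alpha>'' x) - \<alpha> x)"
    by (rule superposition_Baecklund0[OF \<tau> \<phi>[symmetric] C1(1,3,2) B1(2,1)])
  moreover have "superposition \<tau> \<phi>2 \<phi>1 (\<alpha>' x - \<alpha>'' x) = superposition \<tau> \<phi>1 \<phi>2 (\<alpha>'' x - \<alpha>' x)" for x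
    using superposition_commute[of \<tau> \<phi>2 \<phi>1 "\<alpha>'' x - \<alpha>' x"] by simp
  ultimately have B3: "Baecklund0 \<tau> \<phi>1 U \<alpha>'' ?s"
    by simp
  have "(\<exists>k::int. \<forall>x\<in>U. \<beta> x = ?s x + 4 * pi * of_int k) \<or>
      ((\<forall>x\<in>U. \<alpha>'' x = - \<alpha>' x) \<and> (\<exists>k::int. \<forall>x\<in>U. \<beta> x = \<alpha> x + 2 * pi + 4 * pi * of_int k))"
    if \<beta>: "elliptic_sine_Gordon U \<beta>" "Baecklund0 \<tau> \<phi>2 U \<alpha>' \<beta>" "Baecklund0 \<tau> \<phi>1 U \<alpha>'' \<beta>" for \<beta>
  proof -
    have C1\<beta>: "C1_on U \<beta>"
      using \<beta>(1) by (simp add: elliptic_sine_Gordon_def C2_on_def)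
    have spread: "\<forall>x\<in>U. \<beta> x = v x + 4 * pi * of_int k"
      if "C1_on U v" "Baecklund0 \<tau> \<phi>2 U \<alpha>' v" "x0 \<in> U" "\<beta> x0 = v x0 + 4 * pi * of_int k" for v x0 k
      using Baecklund0_unique_continuation[OF U C1(2) C1\<beta> _ \<beta>(2), of "\<lambda>x. v x + 4 * pi * of_int k" x0] that
      by (simp add: C1_on_add_const Baecklund0_add_period)
    note vals = Baecklund0_pair_values[OF \<tau> \<phi> B1 \<beta>(2,3)]
    consider x0 where "x0 \<in> U" "\<alpha>'' x0 \<noteq> - \<alpha>' x0"
      | x0 where "x0 \<in> U" "\<forall>x\<in>U. \<alpha>'' x = - \<alpha>' x" | "U = {}" by blast
    then show ?thesis
    proof cases
      case 1
      then obtain k :: int where "\<beta> x0 = ?s x0 + 4 * pi * of_int k"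
        using vals[OF 1(1)] by blast
      then show ?thesis
        using spread[OF C1s B2 1(1)] by blast
    next
      case 2
      have B4: "Baecklund0 \<tau> \<phi>2 U \<alpha>' (\<lambda>x. \<alpha> x + 2 * pi)"
        using 2(2) by (intro Baecklund0_add_2pi[OF B1(2) U(1) C1(2)]) simp
      have C4: "C1_on U (\<lambda>x. \<alpha> x + 2 * pi)"
        by (simp add: C1_on_add_const C1(1))
      show ?thesis
        using vals[OF 2(1)] spread[OF C1s B2 2(1)] spread[OF C4 B4 2(1)] 2(2) by blast
    qed simp
  qed
  moreover have "\<forall>x\<in>U. tan_half_superposition
       (P_tilde \<tau> \<phi>1 \<phi>2 (\<alpha>' x) (\<alpha>'' x)) (Q_tilde \<phi>1 \<phi>2 (\<alpha>' x) (\<alpha>'' x)) (\<alpha> x) (?s x)"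
    by (simp add: superposition_tan_half[OF \<tau> \<phi>])
  ultimately show ?thesis
    using sG B2 B3 by (intro exI[of _ ?s]) blast
qed

end
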